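(* There exists an exact algorithm that computes a maximum multipacking of any $n$-vertex graph in time $O^*(1.58^n)$.
   Context: All graphs are finite, simple and undirected. For a graph $G=(V,E)$, $N_r[v]=\{u\in V: d(u,v)\le r\}$ where $d$ is the shortest-path distance. A multipacking of $G$ is a set $M\subseteq V$ such that $|N_r[v]\cap M|\le r$ for every $v\in V$ and every integer $r\ge1$; a maximum multipacking is one of maximum cardinality. $O^*(\cdot)$ suppresses factors polynomial in $n$. *)

theory Defs
  imports
    "HOL-Library.Landau_Symbols"
    "Graph_Theory.Pair_Digraph"
    "Graph_Theory.Shortest_Path"
begin

section \<open>Multipackings\<close>

text \<open>
  Finite simple undirected graphs are the instances of the locale \<^locale>\<open>pair_graph\<close>:
  every edge $uv$ is represented by the two arcs $(u,v)$ and $(v,u)$.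
  The distance is \<open>\<infinity>\<close> between vertices of different components.
\<close>

definition graph_dist :: "'a pair_pre_digraph \<Rightarrow> 'a \<Rightarrow> 'a \<Rightarrow> ereal" where
  "graph_dist G u v = wf_digraph.\<mu> (with_proj G) (\<lambda>_. 1) u v"

definition nbhd :: "'a pair_pre_digraph \<Rightarrow> nat \<Rightarrow> 'a \<Rightarrow> 'a set" where
  "nbhd G r v = {u \<in> pverts G. graph_dist G u v \<le> ereal (real r)}"

definition multipacking :: "'a pair_pre_digraph \<Rightarrow> 'a set \<Rightarrow> bool" where
  "multipacking G M \<longleftrightarrow>
     M \<subseteq> pverts G \<and> (\<forall>v \<in> pverts G. \<forall>r\<ge>1. card (nbhd G r v \<inter> M) \<le> r)"

definition maximum_multipacking :: "'a pair_pre_digraph \<Rightarrow> 'a set \<Rightarrow> bool" where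
  "maximum_multipacking G M \<longleftrightarrow>
     multipacking G M \<and> (\<forall>M'. multipacking G M' \<longrightarrow> card M' \<le> card M)"

section \<open>Model of computation\<close>

text \<open>
  Algorithms are programs of a first-order call-by-value functional language (pure Lisp) whose only
  data are binary trees. A program is a finite list of function bodies; \<open>Call f es\<close> invokes
  the \<open>f\<close>-th body, in which \<open>Arg i\<close> refers to the \<open>i\<close>-th actual argument. There are no other
  primitives: in particular no arithmetic and no comparison of trees, only the test for \<open>Leaf\<close>.
  The running time is the number of expression nodes evaluated. With trees represented by pointers,
  each evaluation step takes constant time on a pointer machine, so this time measure agrees with
  that of Turing machines and logarithmic-cost RAMs up to polynomial overhead
  (cf. the languages WHILE and F of N. D. Jones, Computability and Complexity).
  The relation \<open>eval P env e v t\<close> means: in program \<open>P\<close> with actual arguments \<open>env\<close>, the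
  expression \<open>e\<close> evaluates to \<open>v\<close> in exactly \<open>t\<close> steps. Ill-formed references to
  arguments or functions, and non-terminating computations, have no derivation.
\<close>

datatype val = Leaf | Node val val

datatype expr =
    Arg nat
  | LeafE
  | NodeE expr expr
  | Hd expr
  | Tl expr
  | IfLeaf expr expr expr
  | Call nat "expr list"

type_synonym program = "expr list"

fun val_hd :: "val \<Rightarrow> val" where
  "val_hd Leaf = Leaf"
| "val_hd (Node x y) = x"

fun val_tl :: "val \<Rightarrow> val" where
  "val_tl Leaf = Leaf"
| "val_tl (Node x y) = y"

inductive eval :: "program \<Rightarrow> val list \<Rightarrow> expr \<Rightarrow> val \<Rightarrow> nat \<Rightarrow> bool"
  and eval_list :: "program \<Rightarrow> val list \<Rightarrow> expr list \<Rightarrow> val list \<Rightarrow> nat \<Rightarrow> bool"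
  for P :: program where
  eval_Arg: "i < length env \<Longrightarrow> eval P env (Arg i) (env ! i) 1"
| eval_LeafE: "eval P env LeafE Leaf 1"
| eval_NodeE: "eval P env a x s \<Longrightarrow> eval P env b y t \<Longrightarrow>
    eval P env (NodeE a b) (Node x y) (1 + s + t)"
| eval_Hd: "eval P env a x s \<Longrightarrow> eval P env (Hd a) (val_hd x) (1 + s)"
| eval_Tl: "eval P env a x s \<Longrightarrow> eval P env (Tl a) (val_tl x) (1 + s)"
| eval_IfLeaf_Leaf: "eval P env c Leaf s \<Longrightarrow> eval P env a x t \<Longrightarrow>
    eval P env (IfLeaf c a b) x (1 + s + t)"
| eval_IfLeaf_Node: "eval P env c (Node u w) s \<Longrightarrow> eval P env b x t \<Longrightarrow>
    eval P env (IfLeaf c a b) x (1 + s + t)"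
| eval_Call: "f < length P \<Longrightarrow> eval_list P env es xs s \<Longrightarrow> eval P xs (P ! f) x t \<Longrightarrow>
    eval P env (Call f es) x (1 + s + t)"
| eval_list_Nil: "eval_list P env [] [] 0"
| eval_list_Cons: "eval P env e x s \<Longrightarrow> eval_list P env es xs t \<Longrightarrow>
    eval_list P env (e # es) (x # xs) (s + t)"

inductive_cases eval_ArgE: "eval P env (Arg i) v t"
inductive_cases eval_LeafEE: "eval P env LeafE v t"
inductive_cases eval_NodeEE: "eval P env (NodeE a b) v t"
inductive_cases eval_HdE: "eval P env (Hd a) v t"
inductive_cases eval_TlE: "eval P env (Tl a) v t"
inductive_cases eval_IfLeafE: "eval P env (IfLeaf c a b) v t"
inductive_cases eval_CallE: "eval P env (Call f es) v t"
inductive_cases eval_list_NilE: "eval_list P env [] vs t"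
inductive_cases eval_list_ConsE: "eval_list P env (e # es) vs t"

lemma eval_deterministic:
  "eval P env e v t \<Longrightarrow> eval P env e v' t' \<Longrightarrow> v' = v \<and> t' = t"
  "eval_list P env es vs s \<Longrightarrow> eval_list P env es vs' s' \<Longrightarrow> vs' = vs \<and> s' = s"
proof (induction arbitrary: v' t' and vs' s' rule: eval_eval_list.inducts)
  case (eval_Arg i env)
  then show ?case by (auto elim: eval_ArgE)
next
  case (eval_LeafE env)
  then show ?case by (auto elim: eval_LeafEE)
next
  case (eval_NodeE env a x s b y t)
  from eval_NodeE.prems show ?case by (auto elim!: eval_NodeEE dest!: eval_NodeE.IH(2,4))
next
  case (eval_Hd env a x s)
  from eval_Hd.prems show ?case by (auto elim!: eval_HdE dest!: eval_Hd.IH(2))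
next
  case (eval_Tl env a x s)
  from eval_Tl.prems show ?case by (auto elim!: eval_TlE dest!: eval_Tl.IH(2))
next
  case (eval_IfLeaf_Leaf env c s a x t b)
  from eval_IfLeaf_Leaf.prems show ?case by (auto elim!: eval_IfLeafE dest!: eval_IfLeaf_Leaf.IH(2,4))
next
  case (eval_IfLeaf_Node env c u w s b x t a)
  from eval_IfLeaf_Node.prems show ?case by (auto elim!: eval_IfLeafE dest!: eval_IfLeaf_Node.IH(2,4))
next
  case (eval_Call f env es xs s x t)
  from eval_Call.prems show ?case by (auto elim!: eval_CallE dest!: eval_Call.IH(3,5))
next
  case (eval_list_Nil env)
  then show ?case by (auto elim: eval_list_NilE)
next
  case (eval_list_Cons env e x s es xs t)
  from eval_list_Cons.prems show ?case by (auto elim!: eval_list_ConsE dest!: eval_list_Cons.IH(2,4))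
qed

definition computes_within :: "program \<Rightarrow> val \<Rightarrow> val \<Rightarrow> nat \<Rightarrow> bool" where
  "computes_within P x y T \<longleftrightarrow> (\<exists>t\<le>T. eval P [x] (Call 0 [Arg 0]) y t)"

section \<open>Encoding of inputs and outputs\<close>

text \<open>
  A graph with vertex set \<open>{..<n}\<close> is given by its adjacency matrix, a list of \<open>n\<close> rows of \<open>n\<close>
  truth values; a set of vertices is given by its characteristic vector of length \<open>n\<close>.
\<close>

definition encode_bool :: "bool \<Rightarrow> val" where
  "encode_bool b = (if b then Node Leaf Leaf else Leaf)"

definition encode_list :: "('a \<Rightarrow> val) \<Rightarrow> 'a list \<Rightarrow> val" where
  "encode_list enc xs = foldr (\<lambda>x. Node (enc x)) xs Leaf"

definition encode_graph :: "nat \<Rightarrow> nat pair_pre_digraph \<Rightarrow> val" where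
  "encode_graph n G =
     encode_list (encode_list encode_bool) (map (\<lambda>u. map (\<lambda>v. (u, v) \<in> parcs G) [0..<n]) [0..<n])"

definition encode_vertex_set :: "nat \<Rightarrow> nat set \<Rightarrow> val" where
  "encode_vertex_set n M = encode_list encode_bool (map (\<lambda>v. v \<in> M) [0..<n])"

section \<open>The class $O^*(g)$\<close>

definition O_star :: "(nat \<Rightarrow> real) \<Rightarrow> (nat \<Rightarrow> real) set" where
  "O_star g = (\<Union>k::nat. O(\<lambda>n. real n ^ k * g n))"

end

theory Submission
  imports Defs
begin

text \<open>
  If \<open>N(u) \<noteq> {}\<close> and \<open>N(u) \<subseteq> N[v]\<close> for some \<open>u \<noteq> v\<close>, then \<open>v\<close> can be exchanged for \<open>u\<close> in every
  multipacking. Greedily discarding such \<open>v\<close> leaves a set \<open>C\<close> of candidates that still contains a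
  maximum multipacking. Isolated vertices are always taken. The algorithm enumerates all
  multipackings inside \<open>C\<close> by branching on the vertices in order; as subsets of multipackings are
  multipackings, every branch that is not pruned leads to a solution, and the search tree has at
  most \<open>n + 1\<close> nodes per solution.

  By the case \<open>r = 1\<close>, the closed neighborhoods of the members of a multipacking are disjoint, so
  it suffices to bound the number of packings of closed neighborhoods of non-isolated candidates.
  Since no candidate dominates another one, a leaf conflicts with no other candidate, and two
  conflicting candidates have closed neighborhoods of size at least 3 whose union has size at
  least 4. A weighted branching argument then gives the bound \<open>1.58^n\<close>.
\<close>

section \<open>Counting packings\<close>

definition packings :: "('a \<Rightarrow> 'b set) \<Rightarrow> 'a set \<Rightarrow> 'a set set" where
  "packings S C = {X. X \<subseteq> C \<and> disjoint_family_on S X}"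

lemma finite_packings: "finite C \<Longrightarrow> finite (packings S C)"
  by (rule finite_subset[of _ "Pow C"]) (auto simp: packings_def)

lemma packings_remove: "X \<in> packings S C \<Longrightarrow> X - Y \<in> packings S (C - Y)"
  by (auto simp: packings_def disjoint_family_on_def)

definition conflicts :: "('a \<Rightarrow> 'b set) \<Rightarrow> 'a set \<Rightarrow> 'a \<Rightarrow> 'a set" where
  "conflicts S C v = {u \<in> C. u \<noteq> v \<and> S u \<inter> S v \<noteq> {}}"

text \<open>Either \<open>v\<close> is left out, or choosing it excludes every candidate in conflict
  with it.\<close>

lemma packings_subset_branch:
  "packings S C \<subseteq> packings S (C - {v}) \<union> insert v ` packings S (C - insert v (conflicts S C v))"
proof
  fix X assume X: "X \<in> packings S C"
  show "X \<in> packings S (C - {v}) \<union> insert v ` packings S (C - insert v (conflicts S C v))"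
  proof (cases "v \<in> X")
    case True
    then have "X - {v} \<in> packings S (C - insert v (conflicts S C v))"
      using X by (auto simp: packings_def conflicts_def disjoint_family_on_def)
    then show ?thesis using True by (metis UnI2 image_eqI insert_Diff)
  next
    case False
    then show ?thesis using packings_remove[OF X, of "{v}"] by simp
  qed
qed

lemma card_packings_branch:
  assumes "finite C"
  shows "card (packings S C) \<le>
    card (packings S (C - {v})) + card (packings S (C - insert v (conflicts S C v)))"
proof -
  have "card (packings S C) \<le>
    card (packings S (C - {v}) \<union> insert v ` packings S (C - insert v (conflicts S C v)))"
    using assms by (intro card_mono packings_subset_branch) (auto intro: finite_packings)
  also have "\<dots> \<le> card (packings S (C - {v})) +
      card (insert v ` packings S (C - insert v (conflicts S C v)))"
    by (rule card_Un_le)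
  also have "card (insert v ` packings S (C - insert v (conflicts S C v))) \<le>
      card (packings S (C - insert v (conflicts S C v)))"
    using assms by (intro card_image_le finite_packings) auto
  finally show ?thesis by simp
qed

text \<open>Accounts for the elements used up in a branch: once those of \<open>A\<close> are
  occupied, no candidate in \<open>D\<close> covers any of them, so the number of coverable elements
  drops by at least \<open>card A\<close>.\<close>

lemma card_Union_remove:
  assumes "finite C" "\<And>v. v \<in> C \<Longrightarrow> finite (S v)" "D \<subseteq> C" "A \<subseteq> (\<Union>v\<in>C. S v)"
    and "\<And>v. v \<in> D \<Longrightarrow> S v \<inter> A = {}"
  shows "card (\<Union>v\<in>D. S v) + card A \<le> card (\<Union>v\<in>C. S v)"
proof -
  have fin: "finite (\<Union>v\<in>C. S v)" using assms by auto
  have "(\<Union>v\<in>D. S v) \<inter> A = {}" using assms(5) by blast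
  moreover have "finite (\<Union>v\<in>D. S v)" "finite A"
    using assms(3,4) by (auto intro: finite_subset[OF _ fin])
  ultimately have "card (\<Union>v\<in>D. S v) + card A = card ((\<Union>v\<in>D. S v) \<union> A)"
    by (intro card_Un_disjoint[symmetric])
  also have "\<dots> \<le> card (\<Union>v\<in>C. S v)"
    using assms by (intro card_mono fin) auto
  finally show ?thesis .
qed

text \<open>
  The constants 1.38 and 1.14 weigh the candidates and the elements that can still be covered.
  They are chosen such that each branching rule below is paid for while their product stays below
  1.58: 1/x + 1/(x y)^3 \<le> 1, x^2 y^4 \<ge> 3 and x y^3 \<ge> 2.
\<close>

lemma card_packings_weighted:
  assumes "finite C"
    and "\<And>v. v \<in> C \<Longrightarrow> finite (S v)"
    and "\<And>v. v \<in> C \<Longrightarrow> 3 \<le> card (S v)"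
    and "\<And>u v. \<lbrakk>u \<in> C; v \<in> C; u \<noteq> v; S u \<inter> S v \<noteq> {}\<rbrakk> \<Longrightarrow> 4 \<le> card (S u \<union> S v)"
  shows "real (card (packings S C)) \<le> 1.38 ^ card C * 1.14 ^ card (\<Union>v\<in>C. S v)"
  using assms
proof (induction "card C" arbitrary: C rule: less_induct)
  case less
  let ?p = "\<lambda>D. real (card (packings S D))"
  let ?U = "\<lambda>D. card (\<Union>v\<in>D. S v)"
  note fin = less.prems(1,2)
  \<comment> \<open>Induction hypothesis in the form the branching rules need: a subproblem with at
    least \<open>i\<close> fewer candidates and \<open>j\<close> fewer elements uses at most a
    fraction \<open>1 / (1.38^i * 1.14^j)\<close> of the bound.\<close>
  have sub: "?p D * (1.38 ^ i * 1.14 ^ j) \<le> 1.38 ^ card C * 1.14 ^ ?U C"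
    if "D \<subset> C" "card D + i \<le> card C" "?U D + j \<le> ?U C" for D i j
  proof -
    have "?p D \<le> 1.38 ^ card D * 1.14 ^ ?U D"
    proof (rule less.hyps)
      show "4 \<le> card (S u \<union> S v)" if "u \<in> D" "v \<in> D" "u \<noteq> v" "S u \<inter> S v \<noteq> {}" for u v
        using that \<open>D \<subset> C\<close> by (intro less.prems(4)) auto
    qed (use that less.prems in \<open>auto intro: finite_subset psubset_card_mono\<close>)
    then have "?p D * (1.38 ^ i * 1.14 ^ j) \<le> 1.38 ^ card D * 1.14 ^ ?U D * (1.38 ^ i * 1.14 ^ j)"
      by (intro mult_right_mono) auto
    also have "\<dots> = 1.38 ^ (card D + i) * 1.14 ^ (?U D + j)" by (simp add: power_add)
    also have "\<dots> \<le> 1.38 ^ card C * 1.14 ^ ?U C"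
      using that by (intro mult_mono power_increasing) auto
    finally show ?thesis .
  qed
  show ?case
  \<comment> \<open>Choosing a candidate with two conflicts removes at least three candidates and
    three elements; this pays for the branching since \<open>1 / 1.38 + 1 / (1.38 * 1.14)^3\<close>
    is below 1.\<close>
  proof (cases "\<exists>v\<in>C. 2 \<le> card (conflicts S C v)")
    case True
    then obtain v where v: "v \<in> C" "2 \<le> card (conflicts S C v)" by blast
    let ?A = "C - {v}" and ?B = "C - insert v (conflicts S C v)"
    have fc: "finite (conflicts S C v)" "v \<notin> conflicts S C v" "conflicts S C v \<subseteq> C"
      using fin by (auto simp: conflicts_def)
    have "?p ?A * (1.38 ^ 1 * 1.14 ^ 0) \<le> 1.38 ^ card C * 1.14 ^ ?U C"
    proof (rule sub)
      show "card ?A + 1 \<le> card C" using card.remove[OF fin(1) v(1)] by simp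
      show "?U ?A + 0 \<le> ?U C" using fin by (auto intro!: card_mono)
    qed (use v in auto)
    moreover have "?p ?B * (1.38 ^ 3 * 1.14 ^ 3) \<le> 1.38 ^ card C * 1.14 ^ ?U C"
    proof (rule sub)
      have "card (insert v (conflicts S C v)) \<le> card C"
        using fc v fin by (intro card_mono) auto
      then show "card ?B + 3 \<le> card C"
        using v fc fin by (subst card_Diff_subset) auto
      have "?U ?B + card (S v) \<le> ?U C"
        using v fin by (intro card_Union_remove) (auto simp: conflicts_def)
      then show "?U ?B + 3 \<le> ?U C" using less.prems(3)[OF v(1)] by linarith
    qed (use v in auto)
    moreover have "?p C \<le> ?p ?A + ?p ?B"
      using card_packings_branch[OF fin(1), of S v] by linarith
    ultimately show ?thesis by (simp add: power_numeral_reduce)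
  next
    case False
    then have few: "card (conflicts S C v) \<le> 1" if "v \<in> C" for v using that by force
    show ?thesis
    \<comment> \<open>Conflicts now form a matching. A conflicting pair allows three choices:
      neither, \<open>v\<close>, or \<open>u\<close>. It takes two candidates and at least four
      elements, and \<open>1.38^2 * 1.14^4\<close> exceeds 3.\<close>
    proof (cases "\<exists>v\<in>C. conflicts S C v \<noteq> {}")
      case True
      then obtain v u where vu: "v \<in> C" "u \<in> conflicts S C v" by blast
      then have u: "u \<in> C" "u \<noteq> v" "S u \<inter> S v \<noteq> {}" by (auto simp: conflicts_def)
      have fc: "finite (conflicts S C w)" for w using fin by (auto simp: conflicts_def)
      have cv: "conflicts S C v = {u}"
        using card_le_Suc0_iff_eq[OF fc[of v]] few[OF vu(1)] vu(2) by auto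
      have "v \<in> conflicts S C u" using u vu by (auto simp: conflicts_def)
      then have cu: "conflicts S C u = {v}"
        using card_le_Suc0_iff_eq[OF fc[of u]] few[OF u(1)] by auto
      let ?B = "C - {v, u}"
      have "conflicts S (C - {v}) u = {}" using cu by (auto simp: conflicts_def)
      then have "card (packings S (C - {v})) \<le> card (packings S ?B) + card (packings S ?B)"
        using card_packings_branch[of "C - {v}" S u] fin by (simp add: Diff_insert[symmetric] insert_commute)
      then have "card (packings S C) \<le> 3 * card (packings S ?B)"
        using card_packings_branch[OF fin(1), of S v] cv by simp
      then have "?p C \<le> 3 * ?p ?B" by linarith
      moreover have "?p ?B * (1.38 ^ 2 * 1.14 ^ 4) \<le> 1.38 ^ card C * 1.14 ^ ?U C"
      proof (rule sub)
        have "card {v, u} \<le> card C"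
          using u vu fin by (intro card_mono) auto
        then show "card ?B + 2 \<le> card C" using u vu by (subst card_Diff_subset) auto
        have "S w \<inter> (S v \<union> S u) = {}" if "w \<in> ?B" for w
          using that cu cv by (auto simp: conflicts_def)
        then have "?U ?B + card (S v \<union> S u) \<le> ?U C"
          using u vu fin by (intro card_Union_remove) auto
        then show "?U ?B + 4 \<le> ?U C" using less.prems(4)[OF u(1) vu(1) u(2,3)]
          by (simp add: Un_commute)
      qed (use vu in auto)
      ultimately show ?thesis by (simp add: power_numeral_reduce)
    next
      case none: False
      show ?thesis
      proof (cases "C = {}")
        case True
        have "packings S {} = {{}}" by (auto simp: packings_def disjoint_family_on_def)
        then show ?thesis using True by simp
      next
        case False
        then obtain v where v: "v \<in> C" by blast
        let ?B = "C - {v}"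
        have cv: "conflicts S C v = {}" using none v by blast
        \<comment> \<open>A candidate without conflicts at most doubles the count and covers at
          least three elements; \<open>1.38 * 1.14^3\<close> exceeds 2.\<close>
        then have "?p C \<le> 2 * ?p ?B" using card_packings_branch[OF fin(1), of S v] by simp
        moreover have "?p ?B * (1.38 ^ 1 * 1.14 ^ 3) \<le> 1.38 ^ card C * 1.14 ^ ?U C"
        proof (rule sub)
          show "card ?B + 1 \<le> card C" using card.remove[OF fin(1) v] by simp
          have "?U ?B + card (S v) \<le> ?U C"
            using v fin cv by (intro card_Union_remove) (auto simp: conflicts_def)
          then show "?U ?B + 3 \<le> ?U C" using less.prems(3)[OF v] by linarith
        qed (use v in auto)
        ultimately show ?thesis by (simp add: power_numeral_reduce)
      qed
    qed
  qed
qed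

text \<open>A conflict-free candidate is split off at a factor 2, which is below
  \<open>1.58^2\<close>, and takes at least two elements with it. When every candidate has a
  conflict, all sets have size at least 3 and the weighted bound applies.\<close>

lemma card_packings_le:
  assumes "finite C"
    and "\<And>v. v \<in> C \<Longrightarrow> finite (S v)"
    and "\<And>v. v \<in> C \<Longrightarrow> v \<in> S v"
    and "\<And>v. v \<in> C \<Longrightarrow> 2 \<le> card (S v)"
    and "\<And>u v. \<lbrakk>u \<in> C; v \<in> C; u \<noteq> v; S u \<inter> S v \<noteq> {}\<rbrakk> \<Longrightarrow> 3 \<le> card (S u)"
    and "\<And>u v. \<lbrakk>u \<in> C; v \<in> C; u \<noteq> v; S u \<inter> S v \<noteq> {}\<rbrakk> \<Longrightarrow> 4 \<le> card (S u \<union> S v)"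
  shows "real (card (packings S C)) \<le> 1.58 ^ card (\<Union>v\<in>C. S v)"
  using assms
proof (induction "card C" arbitrary: C rule: less_induct)
  case less
  let ?p = "\<lambda>D. real (card (packings S D))"
  let ?U = "\<lambda>D. card (\<Union>v\<in>D. S v)"
  note fin = less.prems(1,2)
  show ?case
  proof (cases "\<exists>v\<in>C. conflicts S C v = {}")
    case True
    then obtain v where v: "v \<in> C" "conflicts S C v = {}" by blast
    let ?B = "C - {v}"
    have "?p ?B \<le> 1.58 ^ ?U ?B"
    proof (rule less.hyps)
      show "3 \<le> card (S x)" if "x \<in> ?B" "y \<in> ?B" "x \<noteq> y" "S x \<inter> S y \<noteq> {}" for x y
        using that by (intro less.prems(5)[of x y]) auto
      show "4 \<le> card (S x \<union> S y)" if "x \<in> ?B" "y \<in> ?B" "x \<noteq> y" "S x \<inter> S y \<noteq> {}" for x y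
        using that by (intro less.prems(6)) auto
      show "card ?B < card C" using fin(1) v(1) by (rule card_Diff1_less)
    qed (use less.prems in auto)
    moreover have "?p C \<le> 2 * ?p ?B" using card_packings_branch[OF fin(1), of S v] v by simp
    ultimately have "?p C \<le> 1.58 ^ ?U ?B * 1.58 ^ 2"
      by (simp add: power2_eq_square)
    also have "\<dots> = 1.58 ^ (?U ?B + 2)" by (simp only: power_add)
    also have "\<dots> \<le> 1.58 ^ ?U C"
    proof (rule power_increasing)
      have "?U ?B + card (S v) \<le> ?U C"
        using v fin by (intro card_Union_remove) (auto simp: conflicts_def)
      then show "?U ?B + 2 \<le> ?U C" using less.prems(4)[OF v(1)] by linarith
    qed simp
    finally show ?thesis .
  next
    case False
    have "?p C \<le> 1.38 ^ card C * 1.14 ^ ?U C"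
    proof (rule card_packings_weighted)
      show "3 \<le> card (S v)" if "v \<in> C" for v
        using that False less.prems(5)[of v] by (fastforce simp: conflicts_def)
    qed (use less.prems in auto)
    \<comment> \<open>Each candidate belongs to its own set, so \<open>C\<close> lies in the union
      and both weights can be charged to elements; \<open>1.38 * 1.14 = 1.5732\<close>.\<close>
    also have "\<dots> \<le> 1.38 ^ ?U C * 1.14 ^ ?U C"
      using less.prems by (intro mult_right_mono power_increasing card_mono) auto
    also have "\<dots> = (1.38 * 1.14) ^ ?U C" by (simp only: power_mult_distrib)
    also have "\<dots> \<le> 1.58 ^ ?U C" by (intro power_mono) auto
    finally show ?thesis .
  qed
qed

section \<open>Neighborhoods and multipackings\<close>

definition neighbors :: "'a pair_pre_digraph \<Rightarrow> 'a \<Rightarrow> 'a set" where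
  "neighbors G u = {w. (u, w) \<in> parcs G}"

definition isolated :: "'a pair_pre_digraph \<Rightarrow> 'a set" where
  "isolated G = {v \<in> pverts G. neighbors G v = {}}"

text \<open>The inclusion allows \<open>v\<close> to be a neighbor of \<open>u\<close>, so a leaf
  dominates its neighbor. Nonemptiness keeps isolated vertices from dominating every other
  vertex.\<close>

definition nbr_dominates :: "'a pair_pre_digraph \<Rightarrow> 'a \<Rightarrow> 'a \<Rightarrow> bool" where
  "nbr_dominates G u v \<longleftrightarrow>
     u \<noteq> v \<and> neighbors G u \<noteq> {} \<and> neighbors G u \<subseteq> insert v (neighbors G v)"

text \<open>Unit costs make walk costs integral: if every walk were longer than \<open>r\<close>,
  the infimum would be at least \<open>Suc r\<close>. This covers the case without walks, where it
  is \<infinity>.\<close>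

lemma (in pair_wf_digraph) graph_dist_le_iff:
  "graph_dist G u v \<le> ereal (real r) \<longleftrightarrow> (\<exists>p. awalk u p v \<and> length p \<le> r)"
proof -
  have cost: "awalk_cost (\<lambda>_. 1) p = real (length p)" for p :: "('a \<times> 'a) list"
    by (induction p) auto
  show ?thesis
  proof
    assume le: "graph_dist G u v \<le> ereal (real r)"
    show "\<exists>p. awalk u p v \<and> length p \<le> r"
    proof (rule ccontr)
      assume "\<not> (\<exists>p. awalk u p v \<and> length p \<le> r)"
      then have "ereal (real (Suc r)) \<le> \<mu> (\<lambda>_. 1) u v"
        unfolding \<mu>_def cost by (intro INF_greatest) (force simp: not_le)
      then have "ereal (real (Suc r)) \<le> ereal (real r)"
        using le unfolding graph_dist_def by (rule order_trans)
      then show False by simp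
    qed
  next
    assume "\<exists>p. awalk u p v \<and> length p \<le> r"
    then obtain p where p: "awalk u p v" "length p \<le> r" by blast
    have "\<mu> (\<lambda>_. 1) u v \<le> ereal (real (length p))"
      unfolding \<mu>_def cost using p by (intro INF_lower) auto
    also have "\<dots> \<le> ereal (real r)" using p by simp
    finally show "graph_dist G u v \<le> ereal (real r)" unfolding graph_dist_def .
  qed
qed

context pair_wf_digraph
begin

lemma nbhd_0: "v \<in> pverts G \<Longrightarrow> nbhd G 0 v = {v}"
  by (auto simp: nbhd_def graph_dist_le_iff[of _ _ 0, simplified] awalk_Nil_iff)

text \<open>Splitting off the first arc of a walk turns balls into a recursion by one-step
  expansion, which is how the program computes them.\<close>

lemma nbhd_Suc: "nbhd G (Suc r) v = nbhd G r v \<union> {u. \<exists>w\<in>nbhd G r v. (u, w) \<in> parcs G}"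
proof (rule set_eqI)
  fix u
  have "(\<exists>p. awalk u p v \<and> length p \<le> Suc r) \<longleftrightarrow>
    (\<exists>p. awalk u p v \<and> length p \<le> r) \<or> (\<exists>w. (u, w) \<in> parcs G \<and> (\<exists>p. awalk w p v \<and> length p \<le> r))"
    (is "?L \<longleftrightarrow> ?R")
  proof
    assume ?L
    then obtain p where p: "awalk u p v" "length p \<le> Suc r" by blast
    then show ?R by (cases p) (auto simp: awalk_Cons_iff)
  next
    assume ?R
    then show ?L
    proof (elim disjE exE conjE)
      fix w p assume "(u, w) \<in> parcs G" "awalk w p v" "length p \<le> r"
      then have "awalk u ((u, w) # p) v \<and> length ((u, w) # p) \<le> Suc r"
        by (auto simp: awalk_Cons_iff)
      then show ?L by blast
    qed auto
  qed
  then show "u \<in> nbhd G (Suc r) v \<longleftrightarrow> u \<in> nbhd G r v \<union> {u. \<exists>w\<in>nbhd G r v. (u, w) \<in> parcs G}"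
    unfolding nbhd_def graph_dist_le_iff by (auto dest: wellformed')
qed

lemma nbhd_mono: "r \<le> s \<Longrightarrow> nbhd G r v \<subseteq> nbhd G s v"
  by (induction s rule: dec_induct) (auto simp: nbhd_Suc)

lemma nbhd_subset: "nbhd G r v \<subseteq> pverts G"
  by (auto simp: nbhd_def)

end

lemma (in pair_graph) finite_nbhd: "finite (nbhd G r v)"
  by (rule finite_subset[OF nbhd_subset pair_finite_verts])

lemma (in pair_graph) neighbors_sym: "u \<in> neighbors G v \<longleftrightarrow> v \<in> neighbors G u"
  by (auto simp: neighbors_def intro: arcs_symmetric)

lemma (in pair_graph) nbhd_1: "v \<in> pverts G \<Longrightarrow> nbhd G 1 v = insert v (neighbors G v)"
  by (auto simp: nbhd_Suc nbhd_0 neighbors_def intro: arcs_symmetric)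

lemma (in pair_graph) neighbors_subset: "neighbors G v \<subseteq> pverts G"
  by (auto simp: neighbors_def wellformed')

lemma (in pair_graph) neighbors_irrefl: "v \<notin> neighbors G v"
  by (auto simp: neighbors_def dest: pair_no_loops)

section \<open>Closure properties and exchange arguments for multipackings\<close>

context pair_graph
begin

text \<open>Intersections with balls only shrink. This heredity makes pruning sound: a set that is
  no multipacking cannot be extended to one.\<close>

lemma multipacking_subset:
  assumes "multipacking G M" "X \<subseteq> M"
  shows "multipacking G X"
  unfolding multipacking_def
proof (intro conjI ballI allI impI)
  show "X \<subseteq> pverts G" using assms by (auto simp: multipacking_def)
  fix v r assume "v \<in> pverts G" "(1::nat) \<le> r"
  then have "card (nbhd G r v \<inter> M) \<le> r" using assms by (auto simp: multipacking_def)
  moreover have "card (nbhd G r v \<inter> X) \<le> card (nbhd G r v \<inter> M)"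
    using assms(2) finite_nbhd by (intro card_mono) auto
  ultimately show "card (nbhd G r v \<inter> X) \<le> r" by linarith
qed

text \<open>A vertex common to two closed neighborhoods would be the center of a ball of radius 1
  with two members.\<close>

lemma multipacking_disjoint:
  assumes "multipacking G M"
  shows "disjoint_family_on (\<lambda>v. insert v (neighbors G v)) M"
  unfolding disjoint_family_on_def
proof (intro ballI impI, rule ccontr)
  fix u v assume uv: "u \<in> M" "v \<in> M" "u \<noteq> v"
    and "insert u (neighbors G u) \<inter> insert v (neighbors G v) \<noteq> {}"
  then obtain w where w: "w \<in> insert u (neighbors G u)" "w \<in> insert v (neighbors G v)" by blast
  have "w \<in> pverts G" using w(1) uv(1) assms neighbors_subset by (auto simp: multipacking_def)
  moreover from this have "{u, v} \<subseteq> nbhd G 1 w"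
    using w by (auto simp: nbhd_1 neighbors_sym simp del: One_nat_def)
  ultimately have "card {u, v} \<le> 1"
    using assms uv finite_nbhd
    by (intro order_trans[OF card_mono[of "nbhd G 1 w \<inter> M" "{u, v}"]])
      (auto simp: multipacking_def simp del: One_nat_def)
  then show False using uv by simp
qed

text \<open>No arc enters or leaves \<open>v\<close>, so a ball containing \<open>v\<close> is
  centered at \<open>v\<close> and never grows.\<close>

lemma nbhd_isolated:
  assumes "v \<in> isolated G" "v \<in> nbhd G r x \<or> x = v"
  shows "nbhd G r x \<subseteq> {v}"
proof -
  have "nbhd G s v \<subseteq> {v}" for s
    using assms(1)
    by (induction s) (auto simp: nbhd_Suc nbhd_0 isolated_def neighbors_def dest: arcs_symmetric)
  moreover have "v \<in> nbhd G s x \<Longrightarrow> x = v" for s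
  proof (induction s)
    case 0
    then show ?case by (auto simp: nbhd_def graph_dist_le_iff[of _ _ 0, simplified] awalk_Nil_iff)
  next
    case (Suc s)
    then show ?case using assms(1) by (auto simp: nbhd_Suc isolated_def neighbors_def)
  qed
  ultimately show ?thesis using assms(2) by blast
qed

lemma multipacking_insert_isolated:
  assumes "multipacking G M" "v \<in> isolated G"
  shows "multipacking G (insert v M)"
  unfolding multipacking_def
proof (intro conjI ballI allI impI)
  show "insert v M \<subseteq> pverts G" using assms by (auto simp: multipacking_def isolated_def)
  fix x r assume x: "x \<in> pverts G" "(1::nat) \<le> r"
  show "card (nbhd G r x \<inter> insert v M) \<le> r"
  proof (cases "v \<in> nbhd G r x")
    case True
    then have "nbhd G r x \<inter> insert v M \<subseteq> {v}" using nbhd_isolated[OF assms(2)] by blast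
    then have "card (nbhd G r x \<inter> insert v M) \<le> card {v}" by (intro card_mono) auto
    then show ?thesis using x by simp
  next
    case False
    then show ?thesis using assms x by (auto simp: multipacking_def)
  qed
qed

lemma multipacking_Un_isolated:
  assumes "multipacking G M" "I \<subseteq> isolated G"
  shows "multipacking G (M \<union> I)"
proof -
  have "I \<subseteq> pverts G" using assms(2) by (auto simp: isolated_def)
  then have "finite I" using pair_finite_verts by (rule finite_subset)
  then show ?thesis using assms(2)
    by (induction I) (auto simp: assms(1) multipacking_insert_isolated)
qed

lemma nbhd_dominates:
  assumes "nbr_dominates G u v" "u \<in> nbhd G r x" "x \<noteq> u" "x \<in> pverts G"
  shows "v \<in> nbhd G r x"
proof -
  have "u \<in> nbhd G r x \<Longrightarrow> v \<in> nbhd G r x"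
  proof (induction r)
    case 0
    then show ?case using assms(3,4) by (simp add: nbhd_0)
  next
    case (Suc r)
    show ?case
    proof (cases "u \<in> nbhd G r x")
      case True
      then show ?thesis using Suc.IH by (simp add: nbhd_Suc)
    next
      case False
      then obtain w where "w \<in> nbhd G r x" "(u, w) \<in> parcs G" using Suc.prems by (auto simp: nbhd_Suc)
      moreover from this have "w = v \<or> (v, w) \<in> parcs G"
        using assms(1) by (auto simp: nbr_dominates_def neighbors_def)
      ultimately show ?thesis by (auto simp: nbhd_Suc)
    qed
  qed
  then show ?thesis using assms(2) by blast
qed

text \<open>
  A ball around another vertex that contains the dominating vertex \<open>u\<close> also contains \<open>v\<close>, since a
  shortest path to \<open>u\<close> enters through a neighbor of \<open>u\<close>. Only the balls around \<open>u\<close> itself need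
  a separate argument.
\<close>

lemma multipacking_exchange:
  assumes "multipacking G M" "nbr_dominates G u v" "v \<in> M"
  shows "multipacking G (insert u (M - {v}))" and "card (insert u (M - {v})) = card M"
proof -
  obtain z where z: "(u, z) \<in> parcs G" using assms(2) by (auto simp: nbr_dominates_def neighbors_def)
  then have u: "u \<in> pverts G" "u \<noteq> v" using assms(2) by (auto simp: nbr_dominates_def wellformed')
  have MG: "M \<subseteq> pverts G" using assms(1) by (simp add: multipacking_def)
  then have finM: "finite M" using pair_finite_verts by (rule finite_subset)
  have dis: "insert x (neighbors G x) \<inter> insert v (neighbors G v) = {}" if "x \<in> M" "x \<noteq> v" for x
    using multipacking_disjoint[OF assms(1)] assms(3) that unfolding disjoint_family_on_def by blast
  have zv: "z \<in> insert v (neighbors G v)" "z \<in> neighbors G u"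
    using z assms(2) by (auto simp: nbr_dominates_def neighbors_def)
  \<comment> \<open>\<open>z\<close> lies in the closed neighborhoods of both \<open>u\<close> and
    \<open>v\<close>, so disjointness keeps \<open>u\<close> out of \<open>M\<close>.\<close>
  have uM: "u \<notin> M" using dis[of u] zv u by blast
  have "0 < card M" using finM assms(3) by (auto simp: card_gt_0_iff)
  then show "card (insert u (M - {v})) = card M"
    using uM finM assms(3) by simp
  show "multipacking G (insert u (M - {v}))"
    unfolding multipacking_def
  proof (intro conjI ballI allI impI)
    show "insert u (M - {v}) \<subseteq> pverts G" using MG u by auto
    fix x r assume x: "x \<in> pverts G" "(1::nat) \<le> r"
    let ?N = "nbhd G r x"
    have old: "card (?N \<inter> M) \<le> r" using x assms(1) by (auto simp: multipacking_def)
    have fin: "finite (?N \<inter> M)" using finM by simp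
    \<comment> \<open>A ball without \<open>u\<close> gains no member, and a ball with
      \<open>v\<close> trades \<open>v\<close> for \<open>u\<close>. Balls with \<open>u\<close> but
      without \<open>v\<close> remain.\<close>
    consider "u \<notin> ?N" | "v \<in> ?N" | "u \<in> ?N" "v \<notin> ?N" by blast
    then show "card (?N \<inter> insert u (M - {v})) \<le> r"
    proof cases
      case 1
      then have "?N \<inter> insert u (M - {v}) \<subseteq> ?N \<inter> M" by auto
      then show ?thesis using card_mono[OF fin] old by (meson order_trans)
    next
      case 2
      have "card (?N \<inter> insert u (M - {v})) \<le> card (insert u (?N \<inter> M - {v}))"
        using fin by (intro card_mono) auto
      also have "\<dots> \<le> card (?N \<inter> M)"
      proof -
        have "0 < card (?N \<inter> M)" using fin 2 assms(3) by (auto simp: card_gt_0_iff)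
        then show ?thesis using fin 2 assms(3) uM by simp
      qed
      finally show ?thesis using old by simp
    next
      case 3
      then have xu: "x = u" using nbhd_dominates[OF assms(2)] x by blast
      \<comment> \<open>Through \<open>z\<close>, the vertex \<open>v\<close> is within two steps of
        \<open>u\<close>, hence \<open>r = 1\<close> and the ball is the closed neighborhood of
        \<open>u\<close>. Apart from \<open>u\<close>, it lies in that of \<open>v\<close>, where
        \<open>v\<close> is the only member of \<open>M\<close>.\<close>
      have "v \<in> nbhd G 2 u"
        using zv u neighbors_sym[of z v] neighbors_sym[of z u]
        by (auto simp: numeral_2_eq_2 nbhd_Suc nbhd_0 neighbors_def)
      then have "r < 2" using 3(2) nbhd_mono[of 2 r u] xu by (auto simp: not_less[symmetric])
      then have r: "r = 1" using x by simp
      have "y \<notin> ?N" if "y \<in> M" "y \<noteq> v" for y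
      proof
        assume "y \<in> ?N"
        then have "y \<in> neighbors G u" using that uM u by (auto simp: r xu nbhd_1 simp del: One_nat_def)
        then have "y \<in> insert v (neighbors G v)" using assms(2) by (auto simp: nbr_dominates_def)
        then show False using dis[OF that] by blast
      qed
      then have "?N \<inter> insert u (M - {v}) \<subseteq> {u}" by auto
      then have "card (?N \<inter> insert u (M - {v})) \<le> card {u}" by (intro card_mono) auto
      then show ?thesis using r by simp
    qed
  qed
qed

text \<open>A ball never holds more than \<open>card (pverts G)\<close> members, so larger radii
  impose no condition and a finite check suffices.\<close>

lemma multipacking_iff_bounded:
  assumes "card (pverts G) \<le> n"
  shows "multipacking G M \<longleftrightarrow>
     M \<subseteq> pverts G \<and> (\<forall>v \<in> pverts G. \<forall>r\<in>{1..n}. card (nbhd G r v \<inter> M) \<le> r)"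
proof -
  have "card (nbhd G r v \<inter> M) \<le> r" if "\<not> r \<le> n" for r v
  proof -
    have "card (nbhd G r v \<inter> M) \<le> card (pverts G)"
      using nbhd_subset pair_finite_verts by (intro card_mono) auto
    then show ?thesis using assms that by linarith
  qed
  then show ?thesis unfolding multipacking_def by (metis atLeastAtMost_iff)
qed

text \<open>Turns the absence of domination into the size conditions of
  \<open>card_packings_le\<close>: each of two conflicting candidates has a private neighbor outside
  the closed neighborhood of the other.\<close>

lemma card_packings_neighbors:
  assumes C: "C \<subseteq> pverts G - isolated G"
    and antichain: "\<And>u v. \<lbrakk>u \<in> C; v \<in> C\<rbrakk> \<Longrightarrow> \<not> nbr_dominates G u v"
  shows "real (card (packings (\<lambda>v. insert v (neighbors G v)) C)) \<le> 1.58 ^ card (pverts G)"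
proof -
  let ?S = "\<lambda>v. insert v (neighbors G v)"
  have ne: "neighbors G v \<noteq> {}" if "v \<in> C" for v using that C by (auto simp: isolated_def)
  have fin: "finite (neighbors G v)" for v
    using neighbors_subset pair_finite_verts by (rule finite_subset)
  have finC: "finite C" using C pair_finite_verts by (meson Diff_subset finite_subset subset_trans)
  have priv: "\<exists>p. p \<in> neighbors G u \<and> p \<noteq> v \<and> p \<notin> neighbors G v" if "u \<in> C" "v \<in> C" "u \<noteq> v" for u v
    using antichain[OF that(1,2)] that ne[OF that(1)] by (auto simp: nbr_dominates_def)
  have big: "3 \<le> card (?S u)" "4 \<le> card (?S u \<union> ?S v)"
    if uv: "u \<in> C" "v \<in> C" "u \<noteq> v" and meet: "?S u \<inter> ?S v \<noteq> {}" for u v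
  proof -
    obtain p where p: "p \<in> neighbors G u" "p \<noteq> v" "p \<notin> neighbors G v" using priv[OF uv] by blast
    obtain q where q: "q \<in> neighbors G v" "q \<noteq> u" "q \<notin> neighbors G u"
      using priv[OF uv(2,1)] uv(3) by blast
    have irr: "u \<notin> neighbors G u" "v \<notin> neighbors G v" by (auto simp: neighbors_irrefl)
    \<comment> \<open>If the common vertex is \<open>u\<close> itself, then \<open>v\<close> is
      adjacent to \<open>u\<close> and serves as \<open>w\<close>. So \<open>w\<close> always lies
      in the closed neighborhood of \<open>v\<close> and differs from \<open>p\<close>.\<close>
    obtain w where w: "w \<in> neighbors G u" "w = v \<or> w \<in> neighbors G v"
      using meet neighbors_sym[of u v] uv(3) by auto
    have "card {u, w, p} \<le> card (?S u)" using w p fin by (intro card_mono) auto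
    moreover have "card {u, w, p} = 3" using w p irr by (auto simp: card_insert_if)
    ultimately show "3 \<le> card (?S u)" by simp
    have "card {u, v, p, q} \<le> card (?S u \<union> ?S v)" using p q fin by (intro card_mono) auto
    moreover have "card {u, v, p, q} = 4" using uv p q irr by (auto simp: card_insert_if)
    ultimately show "4 \<le> card (?S u \<union> ?S v)" by simp
  qed
  have "real (card (packings ?S C)) \<le> 1.58 ^ card (\<Union>v\<in>C. ?S v)"
  proof (rule card_packings_le)
    show "2 \<le> card (?S v)" if "v \<in> C" for v
      using ne[OF that] fin by (simp add: neighbors_irrefl Suc_leI card_gt_0_iff)
  qed (use finC fin big in auto)
  also have "\<dots> \<le> 1.58 ^ card (pverts G)"
    using C neighbors_subset by (intro power_increasing card_mono pair_finite_verts) auto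
  finally show ?thesis .
qed

end

section \<open>Symbolic evaluation of programs\<close>

definition halts :: "program \<Rightarrow> nat \<Rightarrow> val list \<Rightarrow> bool" where
  "halts P f xs \<longleftrightarrow> (\<exists>v t. eval P xs (P ! f) v t)"

definition result :: "program \<Rightarrow> nat \<Rightarrow> val list \<Rightarrow> val" where
  "result P f xs = (THE v. \<exists>t. eval P xs (P ! f) v t)"

definition runtime :: "program \<Rightarrow> nat \<Rightarrow> val list \<Rightarrow> nat" where
  "runtime P f xs = (THE t. \<exists>v. eval P xs (P ! f) v t)"

lemma eval_result:
  assumes "eval P xs (P ! f) v t"
  shows "result P f xs = v" "runtime P f xs = t"
  using assms eval_deterministic(1)[OF assms] unfolding result_def runtime_def by blast+

text \<open>A call denotes the opaque \<open>result\<close> of its callee instead of unfolding the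
  body. The recursion is thus structural, and a loop is verified by unfolding one body and rewriting
  the inner call with the induction hypothesis.\<close>

fun denote :: "program \<Rightarrow> val list \<Rightarrow> expr \<Rightarrow> val" where
  "denote P env (Arg i) = env ! i"
| "denote P env LeafE = Leaf"
| "denote P env (NodeE a b) = Node (denote P env a) (denote P env b)"
| "denote P env (Hd a) = val_hd (denote P env a)"
| "denote P env (Tl a) = val_tl (denote P env a)"
| "denote P env (IfLeaf c a b) = (if denote P env c = Leaf then denote P env a else denote P env b)"
| "denote P env (Call f es) = result P f (map (denote P env) es)"

fun cost :: "program \<Rightarrow> val list \<Rightarrow> expr \<Rightarrow> nat" where
  "cost P env (Arg i) = 1"
| "cost P env LeafE = 1"
| "cost P env (NodeE a b) = 1 + cost P env a + cost P env b"
| "cost P env (Hd a) = 1 + cost P env a"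
| "cost P env (Tl a) = 1 + cost P env a"
| "cost P env (IfLeaf c a b) =
     1 + cost P env c + (if denote P env c = Leaf then cost P env a else cost P env b)"
| "cost P env (Call f es) =
     1 + sum_list (map (cost P env) es) + runtime P f (map (denote P env) es)"

fun defined :: "program \<Rightarrow> val list \<Rightarrow> expr \<Rightarrow> bool" where
  "defined P env (Arg i) \<longleftrightarrow> i < length env"
| "defined P env LeafE \<longleftrightarrow> True"
| "defined P env (NodeE a b) \<longleftrightarrow> defined P env a \<and> defined P env b"
| "defined P env (Hd a) \<longleftrightarrow> defined P env a"
| "defined P env (Tl a) \<longleftrightarrow> defined P env a"
| "defined P env (IfLeaf c a b) \<longleftrightarrow>
     defined P env c \<and> (if denote P env c = Leaf then defined P env a else defined P env b)"
| "defined P env (Call f es) \<longleftrightarrow>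
     f < length P \<and> (\<forall>e\<in>set es. defined P env e) \<and> halts P f (map (denote P env) es)"

lemma eval_denote: "defined P env e \<Longrightarrow> eval P env e (denote P env e) (cost P env e)"
proof (induction e)
  case (Arg i)
  then show ?case using eval_Arg[of i env P] by simp
next
  case (IfLeaf c a b)
  show ?case
  proof (cases "denote P env c")
    case Leaf
    then show ?thesis using IfLeaf eval_IfLeaf_Leaf[of P env c] by simp
  next
    case (Node u w)
    then show ?thesis using IfLeaf eval_IfLeaf_Node[of P env c u w] by simp
  qed
next
  case (Call f es)
  have "\<forall>e\<in>set es. eval P env e (denote P env e) (cost P env e)" using Call by auto
  then have "eval_list P env es (map (denote P env) es) (sum_list (map (cost P env) es))"
    by (induction es) (auto intro: eval_list_Nil eval_list_Cons)
  moreover obtain v t where vt: "eval P (map (denote P env) es) (P ! f) v t"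
    using Call.prems by (auto simp: halts_def)
  ultimately show ?case using eval_Call[of f P env es] Call.prems eval_result[OF vt] by simp
qed (use eval_LeafE eval_NodeE eval_Hd eval_Tl in auto)

definition runs :: "program \<Rightarrow> nat \<Rightarrow> val list \<Rightarrow> val \<Rightarrow> nat \<Rightarrow> bool" where
  "runs P f xs v T \<longleftrightarrow> halts P f xs \<and> result P f xs = v \<and> runtime P f xs \<le> T"

lemma runsI:
  assumes "defined P xs (P ! f)" "denote P xs (P ! f) = v" "cost P xs (P ! f) \<le> T"
  shows "runs P f xs v T"
proof -
  note ev = eval_denote[OF assms(1)]
  have "halts P f xs" using ev by (auto simp: halts_def)
  then show ?thesis using eval_result[OF ev] assms by (simp add: runs_def)
qed

lemma runs_mono: "runs P f xs v T \<Longrightarrow> T \<le> T' \<Longrightarrow> runs P f xs v T'"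
  by (auto simp: runs_def)

lemma runs_computes_within:
  assumes "runs P 0 [x] y T" "P \<noteq> []"
  shows "computes_within P x y (T + 2)"
proof -
  obtain v t where vt: "eval P [x] (P ! 0) v t" using assms by (auto simp: runs_def halts_def)
  then have "v = y" "t \<le> T" using eval_result[OF vt] assms by (auto simp: runs_def)
  moreover have "eval_list P [x] [Arg 0] [x] (1 + 0)"
    using eval_list_Cons[OF eval_Arg[of 0 "[x]" P] eval_list_Nil] by simp
  \<comment> \<open>The two additional steps are the outer \<open>Call\<close> and the evaluation of
    its argument.\<close>
  then have "eval P [x] (Call 0 [Arg 0]) v (1 + (1 + 0) + t)"
    using assms(2) vt by (intro eval_Call) auto
  ultimately show ?thesis unfolding computes_within_def by force
qed

section \<open>The program\<close>

definition "f_or = (1::nat)"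
definition "f_step = (2::nat)"
definition "f_count = (3::nat)"
definition "f_balls = (4::nat)"
definition "f_check = (5::nat)"
definition "f_diff = (6::nat)"
definition "f_sub = (7::nat)"
definition "f_nonempty = (8::nat)"
definition "f_dom = (9::nat)"
definition "f_elim = (10::nat)"
definition "f_le = (11::nat)"
definition "f_pick = (12::nat)"
definition "f_search = (13::nat)"
definition "f_norm = (14::nat)"

text \<open>
  Vertex sets are bit lists of arbitrary length, missing bits being 0; the body named after a
  function computes the function with prefix \<open>v\<close> defined below, with the same arguments.
  In loops over the vertices, \<open>e\<close> is the unit vector of the current vertex and \<open>todo\<close> the list of
  the remaining rows. The adjacency matrix itself serves as the initial candidate vector of
  \<open>elim\<close>, because its rows are not \<open>Leaf\<close>.
\<close>

abbreviation TrueE :: expr where "TrueE \<equiv> NodeE LeafE LeafE"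

abbreviation UnitE :: expr where "UnitE \<equiv> NodeE TrueE LeafE"

definition main_body :: expr where
  "main_body =
    Call f_norm [Arg 0, Call f_search [Arg 0, UnitE,
    Call f_elim [Arg 0, UnitE, Arg 0, Arg 0], Arg 0, LeafE]]"

definition or_body :: expr where
  "or_body =
    IfLeaf (Arg 0) (Arg 1) (IfLeaf (Arg 1) (Arg 0)
    (NodeE (IfLeaf (Hd (Arg 0)) (Hd (Arg 1)) (Hd (Arg 0)))
      (Call f_or [Tl (Arg 0), Tl (Arg 1)])))"

definition step_body :: expr where
  "step_body =
    IfLeaf (Arg 1) (Arg 2)
    (Call f_step [Tl (Arg 0), Tl (Arg 1),
      IfLeaf (Hd (Arg 0)) (Arg 2) (Call f_or [Hd (Arg 1), Arg 2])])"

text \<open>Without arithmetic, numbers are unary list lengths: each common element spends one cell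
  of \<open>Arg 2\<close>, and the test fails when an element finds none left.\<close>

definition count_body :: expr where
  "count_body =
    IfLeaf (Arg 0) TrueE
    (IfLeaf (Hd (Arg 0)) (Call f_count [Tl (Arg 0), Tl (Arg 1), Arg 2])
      (IfLeaf (Hd (Arg 1)) (Call f_count [Tl (Arg 0), Tl (Arg 1), Arg 2])
        (IfLeaf (Arg 2) LeafE (Call f_count [Tl (Arg 0), Tl (Arg 1), Tl (Arg 2)]))))"

text \<open>\<open>Arg 1\<close> is a ball, the length of \<open>Arg 2\<close> its radius,
  \<open>Arg 3\<close> the adjacency matrix and \<open>Arg 4\<close> the set under test.
  \<open>Arg 0\<close> is a clock for the radii still to be tested.\<close>

definition balls_body :: expr where
  "balls_body =
    IfLeaf (Arg 0) TrueE
    (IfLeaf (Call f_count [Call f_step [Arg 1, Arg 3, Arg 1], Arg 4, NodeE LeafE (Arg 2)]) LeafE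
      (Call f_balls [Tl (Arg 0), Call f_step [Arg 1, Arg 3, Arg 1], NodeE LeafE (Arg 2),
         Arg 3, Arg 4]))"

definition check_body :: expr where
  "check_body =
    IfLeaf (Arg 0) TrueE
    (IfLeaf (Call f_balls [Arg 2, Arg 1, LeafE, Arg 2, Arg 3]) LeafE
      (Call f_check [Tl (Arg 0), NodeE LeafE (Arg 1), Arg 2, Arg 3]))"

definition diff_body :: expr where
  "diff_body =
    IfLeaf (Arg 0) LeafE
    (NodeE (IfLeaf (Hd (Arg 1)) (Hd (Arg 0)) LeafE) (Call f_diff [Tl (Arg 0), Tl (Arg 1)]))"

definition sub_body :: expr where
  "sub_body =
    IfLeaf (Arg 0) TrueE
    (IfLeaf (Hd (Arg 0)) (Call f_sub [Tl (Arg 0), Tl (Arg 1)])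
      (IfLeaf (Hd (Arg 1)) LeafE (Call f_sub [Tl (Arg 0), Tl (Arg 1)])))"

definition nonempty_body :: expr where
  "nonempty_body =
    IfLeaf (Arg 0) LeafE (IfLeaf (Hd (Arg 0)) (Call f_nonempty [Tl (Arg 0)]) TrueE)"

definition dom_body :: expr where
  "dom_body =
    IfLeaf (Arg 1) LeafE
    (IfLeaf (IfLeaf (Hd (Arg 0)) LeafE
               (IfLeaf (Call f_nonempty [Hd (Arg 1)]) LeafE (Call f_sub [Hd (Arg 1), Arg 2])))
      (Call f_dom [Tl (Arg 0), Tl (Arg 1), Arg 2]) TrueE)"

definition elim_body :: expr where
  "elim_body =
    IfLeaf (Arg 0) (Arg 3)
    (Call f_elim [Tl (Arg 0), NodeE LeafE (Arg 1), Arg 2,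
      IfLeaf (Call f_dom [Call f_diff [Arg 3, Arg 1], Arg 2, Call f_or [Hd (Arg 0), Arg 1]])
        (Arg 3) (Call f_diff [Arg 3, Arg 1])])"

definition le_body :: expr where
  "le_body =
    IfLeaf (Arg 0) TrueE
    (IfLeaf (Hd (Arg 0)) (Call f_le [Tl (Arg 0), Arg 1])
      (IfLeaf (Arg 1) LeafE
        (IfLeaf (Hd (Arg 1)) (Call f_le [Arg 0, Tl (Arg 1)])
          (Call f_le [Tl (Arg 0), Tl (Arg 1)]))))"

definition pick_body :: expr where
  "pick_body =
    IfLeaf (Call f_le [Arg 0, Arg 1]) (Arg 0) (Arg 1)"

definition search_body :: expr where
  "search_body =
    IfLeaf (Arg 0) (Arg 4)
    (IfLeaf (Call f_nonempty [Hd (Arg 0)])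
      (Call f_search [Tl (Arg 0), NodeE LeafE (Arg 1), Tl (Arg 2), Arg 3,
         Call f_or [Arg 1, Arg 4]])
      (IfLeaf (IfLeaf (Hd (Arg 2)) LeafE
                 (Call f_check [Arg 3, UnitE, Arg 3, Call f_or [Arg 1, Arg 4]]))
        (Call f_search [Tl (Arg 0), NodeE LeafE (Arg 1), Tl (Arg 2), Arg 3, Arg 4])
        (Call f_pick
          [Call f_search [Tl (Arg 0), NodeE LeafE (Arg 1), Tl (Arg 2), Arg 3, Arg 4],
           Call f_search [Tl (Arg 0), NodeE LeafE (Arg 1), Tl (Arg 2), Arg 3,
             Call f_or [Arg 1, Arg 4]]])))"

text \<open>Brings the vector to one entry per row and makes each truth value canonical, as the
  output encoding requires.\<close>

definition norm_body :: expr where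
  "norm_body =
    IfLeaf (Arg 0) LeafE
    (NodeE (IfLeaf (Hd (Arg 1)) LeafE TrueE) (Call f_norm [Tl (Arg 0), Tl (Arg 1)]))"

definition prog :: program where
  "prog = [main_body, or_body, step_body, count_body, balls_body, check_body, diff_body, sub_body,
     nonempty_body, dom_body, elim_body, le_body, pick_body, search_body, norm_body]"

lemmas f_defs = f_or_def f_step_def f_count_def f_balls_def f_check_def f_diff_def f_sub_def
  f_nonempty_def f_dom_def f_elim_def f_le_def f_pick_def f_search_def f_norm_def

lemma f_less [simp]:
  "f_or < length prog" "f_step < length prog" "f_count < length prog" "f_balls < length prog"
  "f_check < length prog" "f_diff < length prog" "f_sub < length prog" "f_nonempty < length prog"
  "f_dom < length prog" "f_elim < length prog" "f_le < length prog" "f_pick < length prog"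
  "f_search < length prog" "f_norm < length prog"
  by (simp_all add: prog_def f_defs)

lemma prog_nth:
  "prog ! 0 = main_body" "prog ! f_or = or_body" "prog ! f_step = step_body"
  "prog ! f_count = count_body" "prog ! f_balls = balls_body" "prog ! f_check = check_body"
  "prog ! f_diff = diff_body" "prog ! f_sub = sub_body" "prog ! f_nonempty = nonempty_body"
  "prog ! f_dom = dom_body" "prog ! f_elim = elim_body" "prog ! f_le = le_body"
  "prog ! f_pick = pick_body" "prog ! f_search = search_body" "prog ! f_norm = norm_body"
  by (simp_all add: prog_def f_defs)

section \<open>Functional counterparts of the program bodies\<close>

fun len :: "val \<Rightarrow> nat" where
  "len Leaf = 0"
| "len (Node x a) = Suc (len a)"

fun vor :: "val \<Rightarrow> val \<Rightarrow> val" where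
  "vor Leaf b = b"
| "vor (Node x a) Leaf = Node x a"
| "vor (Node x a) (Node y b) = Node (if x = Leaf then y else x) (vor a b)"

fun vstep :: "val \<Rightarrow> val \<Rightarrow> val \<Rightarrow> val" where
  "vstep b Leaf acc = acc"
| "vstep b (Node row rows) acc =
     vstep (val_tl b) rows (if val_hd b = Leaf then acc else vor row acc)"

fun vcount :: "val \<Rightarrow> val \<Rightarrow> val \<Rightarrow> bool" where
  "vcount Leaf M r \<longleftrightarrow> True"
| "vcount (Node x b) M r \<longleftrightarrow>
     (if x = Leaf \<or> val_hd M = Leaf then vcount b (val_tl M) r
      else r \<noteq> Leaf \<and> vcount b (val_tl M) (val_tl r))"

fun vballs :: "val \<Rightarrow> val \<Rightarrow> val \<Rightarrow> val \<Rightarrow> val \<Rightarrow> bool" where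
  "vballs Leaf b r rows M \<longleftrightarrow> True"
| "vballs (Node x fuel) b r rows M \<longleftrightarrow>
     vcount (vstep b rows b) M (Node Leaf r) \<and> vballs fuel (vstep b rows b) (Node Leaf r) rows M"

fun vcheck :: "val \<Rightarrow> val \<Rightarrow> val \<Rightarrow> val \<Rightarrow> bool" where
  "vcheck Leaf e rows M \<longleftrightarrow> True"
| "vcheck (Node x todo) e rows M \<longleftrightarrow> vballs rows e Leaf rows M \<and> vcheck todo (Node Leaf e) rows M"

fun vdiff :: "val \<Rightarrow> val \<Rightarrow> val" where
  "vdiff Leaf b = Leaf"
| "vdiff (Node x a) b = Node (if val_hd b = Leaf then x else Leaf) (vdiff a (val_tl b))"

fun vsub :: "val \<Rightarrow> val \<Rightarrow> bool" where
  "vsub Leaf b \<longleftrightarrow> True"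
| "vsub (Node x a) b \<longleftrightarrow> (x = Leaf \<or> val_hd b \<noteq> Leaf) \<and> vsub a (val_tl b)"

fun vnonempty :: "val \<Rightarrow> bool" where
  "vnonempty Leaf \<longleftrightarrow> False"
| "vnonempty (Node x a) \<longleftrightarrow> x \<noteq> Leaf \<or> vnonempty a"

fun vdom :: "val \<Rightarrow> val \<Rightarrow> val \<Rightarrow> bool" where
  "vdom C Leaf t \<longleftrightarrow> False"
| "vdom C (Node row rows) t \<longleftrightarrow>
     val_hd C \<noteq> Leaf \<and> vnonempty row \<and> vsub row t \<or> vdom (val_tl C) rows t"

fun velim :: "val \<Rightarrow> val \<Rightarrow> val \<Rightarrow> val \<Rightarrow> val" where
  "velim Leaf e rows C = C"
| "velim (Node row todo) e rows C = velim todo (Node Leaf e) rows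
     (if vdom (vdiff C e) rows (vor row e) then vdiff C e else C)"

function vle :: "val \<Rightarrow> val \<Rightarrow> bool" where
  "vle Leaf b \<longleftrightarrow> True"
| "vle (Node x a) Leaf \<longleftrightarrow> x = Leaf \<and> vle a Leaf"
| "vle (Node x a) (Node y b) \<longleftrightarrow>
     (if x = Leaf then vle a (Node y b) else if y = Leaf then vle (Node x a) b else vle a b)"
  by pat_completeness auto
termination by (relation "measure (\<lambda>(a, b). len a + len b)") auto

definition vpick :: "val \<Rightarrow> val \<Rightarrow> val" where
  "vpick a b = (if vle a b then b else a)"

abbreviation vunit :: val where "vunit \<equiv> Node (Node Leaf Leaf) Leaf"

fun vsearch :: "val \<Rightarrow> val \<Rightarrow> val \<Rightarrow> val \<Rightarrow> val \<Rightarrow> val" where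
  "vsearch Leaf e C rows M = M"
| "vsearch (Node row todo) e C rows M =
    (if \<not> vnonempty row then vsearch todo (Node Leaf e) (val_tl C) rows (vor e M)
     else if val_hd C = Leaf \<or> \<not> vcheck rows vunit rows (vor e M)
     then vsearch todo (Node Leaf e) (val_tl C) rows M
     else vpick (vsearch todo (Node Leaf e) (val_tl C) rows M)
            (vsearch todo (Node Leaf e) (val_tl C) rows (vor e M)))"

text \<open>Follows the recursion of \<open>vsearch\<close>; the count links the running time to the
  number of solutions.\<close>

fun search_leaves :: "val \<Rightarrow> val \<Rightarrow> val \<Rightarrow> val \<Rightarrow> val \<Rightarrow> nat" where
  "search_leaves Leaf e C rows M = 1"
| "search_leaves (Node row todo) e C rows M =
    (if \<not> vnonempty row then search_leaves todo (Node Leaf e) (val_tl C) rows (vor e M)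
     else if val_hd C = Leaf \<or> \<not> vcheck rows vunit rows (vor e M)
     then search_leaves todo (Node Leaf e) (val_tl C) rows M
     else search_leaves todo (Node Leaf e) (val_tl C) rows M +
            search_leaves todo (Node Leaf e) (val_tl C) rows (vor e M))"

fun vnorm :: "val \<Rightarrow> val \<Rightarrow> val" where
  "vnorm Leaf M = Leaf"
| "vnorm (Node x rows) M = Node (encode_bool (val_hd M \<noteq> Leaf)) (vnorm rows (val_tl M))"

section \<open>Running times\<close>

lemma len_vor: "len (vor a b) = max (len a) (len b)"
  by (induction a b rule: vor.induct) auto

lemma len_vdiff: "len (vdiff a b) = len a"
  by (induction a b rule: vdiff.induct) auto

fun rows_le :: "nat \<Rightarrow> val \<Rightarrow> bool" where
  "rows_le m Leaf \<longleftrightarrow> True"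
| "rows_le m (Node row rows) \<longleftrightarrow> len row \<le> m \<and> rows_le m rows"

lemma len_vstep: "rows_le m rows \<Longrightarrow> len acc \<le> m \<Longrightarrow> len (vstep b rows acc) \<le> m"
  by (induction b rows acc rule: vstep.induct) (auto simp: len_vor)

lemma encode_bool_eq_Leaf [simp]: "encode_bool b = Leaf \<longleftrightarrow> \<not> b"
  by (simp add: encode_bool_def)

lemma encode_bool_simps [simp]: "encode_bool True = Node Leaf Leaf" "encode_bool False = Leaf"
  by (simp_all add: encode_bool_def)

lemma runs_or: "runs prog f_or [a, b] (vor a b) (20 * Suc (len a))"
proof (induction a b rule: vor.induct)
  case (3 x a y b)
  from 3[unfolded runs_def] show ?case
    by (intro runsI) (auto simp: prog_nth or_body_def)
qed (intro runsI; simp add: prog_nth or_body_def)+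

lemma runs_step:
  assumes "rows_le m rows" "len acc \<le> m"
  shows "runs prog f_step [b, rows, acc] (vstep b rows acc) (Suc (len rows) * (20 * m + 60))"
proof -
  define K where "K = 20 * m + 60"
  have "runs prog f_step [b, rows, acc] (vstep b rows acc) (Suc (len rows) * K)"
    using assms
  proof (induction b rows acc rule: vstep.induct)
    case (1 b acc)
    show ?case by (intro runsI) (simp_all add: prog_nth step_body_def K_def)
  next
    case (2 b row rows acc)
    have "20 * Suc (len row) + 40 \<le> K" using 2 by (simp add: K_def)
    then show ?case
      using 2 runs_or[of row acc, unfolded runs_def]
      by (intro runsI) (auto simp: prog_nth step_body_def runs_def len_vor)
  qed
  then show ?thesis by (simp add: K_def)
qed

lemma runs_count: "runs prog f_count [b, M, r] (encode_bool (vcount b M r)) (30 * Suc (len b))"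
proof (induction b M r rule: vcount.induct)
  case (1 M r)
  show ?case by (intro runsI) (simp_all add: prog_nth count_body_def encode_bool_def)
next
  case (2 x b M r)
  then show ?case
    by (intro runsI) (auto simp: prog_nth count_body_def runs_def)
qed

lemma runs_diff: "runs prog f_diff [a, b] (vdiff a b) (20 * Suc (len a))"
proof (induction a b rule: vdiff.induct)
  case (1 b)
  show ?case by (intro runsI) (simp_all add: prog_nth diff_body_def)
next
  case (2 x a b)
  then show ?case by (intro runsI) (auto simp: prog_nth diff_body_def runs_def)
qed

lemma runs_sub: "runs prog f_sub [a, b] (encode_bool (vsub a b)) (20 * Suc (len a))"
proof (induction a b rule: vsub.induct)
  case (1 b)
  show ?case by (intro runsI) (simp_all add: prog_nth sub_body_def encode_bool_def)
next
  case (2 x a b)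
  then show ?case by (intro runsI) (auto simp: prog_nth sub_body_def runs_def)
qed

lemma runs_nonempty: "runs prog f_nonempty [a] (encode_bool (vnonempty a)) (20 * Suc (len a))"
proof (induction a rule: vnonempty.induct)
  case 1
  show ?case by (intro runsI) (simp_all add: prog_nth nonempty_body_def)
next
  case (2 x a)
  then show ?case
    by (intro runsI) (auto simp: prog_nth nonempty_body_def runs_def)
qed

lemma runs_norm: "runs prog f_norm [rows, M] (vnorm rows M) (20 * Suc (len rows))"
proof (induction rows M rule: vnorm.induct)
  case (1 M)
  show ?case by (intro runsI) (simp_all add: prog_nth norm_body_def)
next
  case (2 x rows M)
  then show ?case by (intro runsI) (auto simp: prog_nth norm_body_def runs_def encode_bool_def)
qed

lemma runs_le: "runs prog f_le [a, b] (encode_bool (vle a b)) (30 * Suc (len a + len b))"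
proof (induction a b rule: vle.induct)
  case (1 b)
  show ?case by (intro runsI) (simp_all add: prog_nth le_body_def encode_bool_def)
next
  case (2 x a)
  then show ?case by (intro runsI) (auto simp: prog_nth le_body_def runs_def)
next
  case (3 x a y b)
  then show ?case by (intro runsI) (auto simp: prog_nth le_body_def runs_def)
qed

lemma runs_pick: "runs prog f_pick [a, b] (vpick a b) (30 * Suc (len a + len b) + 10)"
  using runs_le[of a b]
  by (intro runsI) (auto simp: prog_nth pick_body_def runs_def vpick_def)

section \<open>Time bounds in terms of a common size bound \<open>m\<close>\<close>

definition step_time :: "nat \<Rightarrow> nat" where "step_time m = Suc m * (20 * m + 60)"
definition balls_time :: "nat \<Rightarrow> nat" where "balls_time m = Suc m * (2 * step_time m + 30 * m + 100)"
definition check_time :: "nat \<Rightarrow> nat" where "check_time m = Suc m * (balls_time m + 50)"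
definition dom_time :: "nat \<Rightarrow> nat" where "dom_time m = Suc m * (40 * m + 100)"
definition elim_time :: "nat \<Rightarrow> nat" where "elim_time m = Suc m * (dom_time m + 60 * m + 200)"

lemma runs_step':
  assumes "rows_le m rows" "len rows \<le> m" "len b \<le> m"
  shows "runs prog f_step [b, rows, b] (vstep b rows b) (step_time m)"
  unfolding step_time_def
  by (rule runs_mono[OF runs_step[OF assms(1,3)]]) (use assms in \<open>intro mult_right_mono, auto\<close>)

lemma runs_balls:
  assumes "rows_le m rows" "len rows \<le> m" "len b \<le> m"
  shows "runs prog f_balls [fuel, b, r, rows, M] (encode_bool (vballs fuel b r rows M))
    (Suc (len fuel) * (2 * step_time m + 30 * m + 100))"
proof -
  define K where "K = 2 * step_time m + 30 * m + 100"
  have "runs prog f_balls [fuel, b, r, rows, M] (encode_bool (vballs fuel b r rows M))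
    (Suc (len fuel) * K)"
    using assms
  proof (induction fuel b r rows M rule: vballs.induct)
    case (1 b r rows M)
    show ?case by (intro runsI) (simp_all add: prog_nth balls_body_def K_def encode_bool_def)
  next
    case (2 x fuel b r rows M)
    have len: "len (vstep b rows b) \<le> m" using 2 by (intro len_vstep) auto
    have "30 * Suc (len (vstep b rows b)) + 2 * step_time m + 60 \<le> K" using len by (simp add: K_def)
    then show ?case
      using "2.IH" "2.prems" len runs_step'[of m rows b] runs_count[of "vstep b rows b" M "Node Leaf r"]
      by (intro runsI) (auto simp: prog_nth balls_body_def runs_def)
  qed
  then show ?thesis by (simp add: K_def)
qed

lemma runs_balls':
  assumes "rows_le m rows" "len rows \<le> m" "len b \<le> m"
  shows "runs prog f_balls [rows, b, r, rows, M] (encode_bool (vballs rows b r rows M)) (balls_time m)"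
  unfolding balls_time_def
  by (rule runs_mono[OF runs_balls[OF assms]]) (use assms in \<open>intro mult_right_mono, auto\<close>)

lemma runs_check:
  assumes "rows_le m rows" "len rows \<le> m" "len todo + len e \<le> Suc m"
  shows "runs prog f_check [todo, e, rows, M] (encode_bool (vcheck todo e rows M))
    (Suc (len todo) * (balls_time m + 50))"
proof -
  define K where "K = balls_time m + 50"
  have "runs prog f_check [todo, e, rows, M] (encode_bool (vcheck todo e rows M))
    (Suc (len todo) * K)"
    using assms
  proof (induction todo e rows M rule: vcheck.induct)
    case (1 e rows M)
    show ?case by (intro runsI) (simp_all add: prog_nth check_body_def K_def encode_bool_def)
  next
    case (2 x todo e rows M)
    have "balls_time m + 40 \<le> K" by (simp add: K_def)
    then show ?case
      using "2.IH" "2.prems" runs_balls'[of m rows e Leaf M]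
      by (intro runsI) (auto simp: prog_nth check_body_def runs_def)
  qed
  then show ?thesis by (simp add: K_def)
qed

lemma runs_check':
  assumes "rows_le m rows" "len rows \<le> m"
  shows "runs prog f_check [rows, vunit, rows, M] (encode_bool (vcheck rows vunit rows M)) (check_time m)"
  unfolding check_time_def
  by (rule runs_mono[OF runs_check[OF assms]]) (use assms in \<open>(intro mult_right_mono)?, auto\<close>)

lemma runs_dom:
  assumes "rows_le m rows"
  shows "runs prog f_dom [C, rows, t] (encode_bool (vdom C rows t)) (Suc (len rows) * (40 * m + 100))"
proof -
  define K where "K = 40 * m + 100"
  have "runs prog f_dom [C, rows, t] (encode_bool (vdom C rows t)) (Suc (len rows) * K)"
    using assms
  proof (induction C rows t rule: vdom.induct)
    case (1 C t)
    show ?case by (intro runsI) (simp_all add: prog_nth dom_body_def K_def encode_bool_def)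
  next
    case (2 C row rows t)
    have "40 * Suc (len row) + 50 \<le> K" using 2 by (simp add: K_def)
    then show ?case
      using "2.IH" "2.prems" runs_nonempty[of row] runs_sub[of row t]
      by (intro runsI) (auto simp: prog_nth dom_body_def runs_def)
  qed
  then show ?thesis by (simp add: K_def)
qed

lemma runs_dom':
  assumes "rows_le m rows" "len rows \<le> m"
  shows "runs prog f_dom [C, rows, t] (encode_bool (vdom C rows t)) (dom_time m)"
  unfolding dom_time_def
  by (rule runs_mono[OF runs_dom[OF assms(1)]]) (use assms in \<open>intro mult_right_mono, auto\<close>)

lemma runs_elim:
  assumes "rows_le m rows" "rows_le m todo" "len rows \<le> m" "len C \<le> m"
  shows "runs prog f_elim [todo, e, rows, C] (velim todo e rows C)
    (Suc (len todo) * (dom_time m + 60 * m + 200))"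
proof -
  define K where "K = dom_time m + 60 * m + 200"
  have "runs prog f_elim [todo, e, rows, C] (velim todo e rows C) (Suc (len todo) * K)"
    using assms
  proof (induction todo e rows C rule: velim.induct)
    case (1 e rows C)
    show ?case by (intro runsI) (simp_all add: prog_nth elim_body_def K_def)
  next
    case (2 row todo e rows C)
    have "dom_time m + 40 * Suc (len C) + 20 * Suc (len row) + 80 \<le> K" using 2 by (simp add: K_def)
    then show ?case
      using "2.IH" "2.prems" runs_dom'[of m rows "vdiff C e" "vor row e"] runs_diff[of C e]
        runs_or[of row e]
      by (intro runsI) (auto simp: prog_nth elim_body_def runs_def len_vdiff)
  qed
  then show ?thesis by (simp add: K_def)
qed

lemma len_vsearch: "len M \<le> m \<Longrightarrow> len todo + len e \<le> Suc m \<Longrightarrow> len (vsearch todo e C rows M) \<le> m"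
  by (induction todo e C rows M rule: vsearch.induct) (auto simp: len_vor vpick_def)

lemma search_leaves_pos: "1 \<le> search_leaves todo e C rows M"
  by (induction todo e C rows M rule: search_leaves.induct) auto

definition search_time :: "nat \<Rightarrow> nat" where "search_time m = check_time m + 200 * m + 500"

lemma runs_search:
  assumes "rows_le m rows" "rows_le m todo" "len rows \<le> m" "len M \<le> m" "len todo + len e \<le> Suc m"
  shows "runs prog f_search [todo, e, C, rows, M] (vsearch todo e C rows M)
    (Suc (len todo) * search_leaves todo e C rows M * search_time m)"
  using assms
proof (induction todo e C rows M rule: vsearch.induct)
  case (1 e C rows M)
  show ?case by (intro runsI) (simp_all add: prog_nth search_body_def search_time_def)
next
  case (2 row todo e C rows M)
  define K where "K = search_time m"
  note IH = "2.IH"[folded K_def]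
  let ?s0 = "vsearch todo (Node Leaf e) (val_tl C) rows M"
  let ?s1 = "vsearch todo (Node Leaf e) (val_tl C) rows (vor e M)"
  let ?l0 = "search_leaves todo (Node Leaf e) (val_tl C) rows M"
  let ?l1 = "search_leaves todo (Node Leaf e) (val_tl C) rows (vor e M)"
  have lens: "len row \<le> m" "len e \<le> m" "len (vor e M) \<le> m" using "2.prems" by (auto simp: len_vor)
  have ls: "len ?s0 \<le> m" "len ?s1 \<le> m" using "2.prems" lens by (intro len_vsearch; simp)+
  have K: "check_time m + 20 * Suc (len row) + 40 * Suc (len e) + 30 * Suc (len ?s0 + len ?s1) + 200 \<le> K"
    using lens ls by (simp add: K_def search_time_def)
  \<comment> \<open>The work at the current node is covered by the additional level, as there is at
    least one leaf.\<close>
  have up: "K + Suc t * l * K \<le> Suc (Suc t) * l * K" if "1 \<le> l" for t l :: nat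
    using mult_le_mono1[OF that, of K] by (simp only: mult_Suc add_mult_distrib nat_mult_1)
  note facts = runs_nonempty[of row, unfolded runs_def] runs_or[of e M, unfolded runs_def]
    runs_check'[of m rows "vor e M", unfolded runs_def] runs_pick[of ?s0 ?s1, unfolded runs_def]
  have "runs prog f_search [Node row todo, e, C, rows, M] (vsearch (Node row todo) e C rows M)
    (K + Suc (len todo) * search_leaves (Node row todo) e C rows M * K)"
  proof (cases "vnonempty row")
    case False
    then show ?thesis
      using IH(1)[unfolded runs_def] "2.prems" facts K lens
      by (intro runsI) (auto simp: prog_nth search_body_def)
  next
    case ne: True
    show ?thesis
    proof (cases "val_hd C = Leaf \<or> \<not> vcheck rows vunit rows (vor e M)")
      case True
      then show ?thesis
        using IH(2)[unfolded runs_def] ne "2.prems" facts K lens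
        by (intro runsI) (auto simp: prog_nth search_body_def)
    next
      case False
      then show ?thesis
        using IH(3,4)[unfolded runs_def] ne "2.prems" facts K lens
        by (intro runsI) (auto simp: prog_nth search_body_def distrib_left distrib_right)
    qed
  qed
  then show ?case unfolding K_def[symmetric] len.simps
    by (rule runs_mono) (intro up search_leaves_pos)
qed

lemma runs_main:
  assumes "rows_le m rows" "len rows \<le> m"
  shows "runs prog 0 [rows] (vnorm rows (vsearch rows vunit (velim rows vunit rows rows) rows Leaf))
    (elim_time m + 20 * m + 100 + 
     Suc m * search_leaves rows vunit (velim rows vunit rows rows) rows Leaf * search_time m)"
proof -
  let ?C = "velim rows vunit rows rows"
  let ?M = "vsearch rows vunit ?C rows Leaf"
  let ?T = "Suc m * search_leaves rows vunit ?C rows Leaf * search_time m"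
  have "runs prog f_elim [rows, vunit, rows, rows] ?C (elim_time m)"
    unfolding elim_time_def using assms
    by (intro runs_mono[OF runs_elim[of m]] mult_right_mono) auto
  moreover have "runs prog f_search [rows, vunit, ?C, rows, Leaf] ?M ?T"
    using assms by (intro runs_mono[OF runs_search[of m]] mult_right_mono) auto
  moreover have "runs prog f_norm [rows, ?M] (vnorm rows ?M) (20 * Suc m)"
    using assms by (intro runs_mono[OF runs_norm] mult_left_mono) auto
  ultimately show ?thesis
    by (intro runsI) (simp_all add: prog_nth main_body_def runs_def)
qed

section \<open>Correctness of the program\<close>

fun bits :: "val \<Rightarrow> nat set" where
  "bits Leaf = {}"
| "bits (Node x a) = (if x = Leaf then {} else {0}) \<union> Suc ` bits a"

fun vnth :: "val \<Rightarrow> nat \<Rightarrow> val" where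
  "vnth Leaf i = Leaf"
| "vnth (Node x a) 0 = x"
| "vnth (Node x a) (Suc i) = vnth a i"

text \<open>Holds for \<open>Leaf\<close> as well, since \<open>val_hd\<close> and
  \<open>val_tl\<close> fix it; a vector that runs out is thus read as zeros.\<close>

lemma bits_unfold: "bits a = (if val_hd a = Leaf then {} else {0}) \<union> Suc ` bits (val_tl a)"
  by (cases a) auto

lemma Suc_in_bits: "Suc i \<in> bits a \<longleftrightarrow> i \<in> bits (val_tl a)"
  by (cases a) auto

lemma finite_bits [simp]: "finite (bits a)"
  by (induction a) auto

lemma card_bits_Node: "card (bits (Node x a)) = (if x = Leaf then 0 else 1) + card (bits a)"
  by (auto simp: card_image card_insert_if)

lemma bits_vor: "bits (vor a b) = bits a \<union> bits b"
  by (induction a b rule: vor.induct) auto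

lemma bits_vdiff: "bits (vdiff a b) = bits a - bits b"
proof (induction a b rule: vdiff.induct)
  case (2 x a b)
  show ?case by (subst (2) bits_unfold) (use 2 in auto)
qed simp

lemma vsub_iff: "vsub a b \<longleftrightarrow> bits a \<subseteq> bits b"
proof (induction a b rule: vsub.induct)
  case (2 x a b)
  show ?case by (subst (2) bits_unfold) (use 2 in auto)
qed simp

lemma vnonempty_iff: "vnonempty a \<longleftrightarrow> bits a \<noteq> {}"
  by (induction a) auto

lemma vcount_iff: "vcount b M r \<longleftrightarrow> card (bits b \<inter> bits M) \<le> len r"
proof (induction b M r rule: vcount.induct)
  case (2 x b M r)
  have "bits (Node x b) \<inter> bits M =
    (if x = Leaf \<or> val_hd M = Leaf then {} else {0}) \<union> Suc ` (bits b \<inter> bits (val_tl M))"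
    by (subst (2) bits_unfold) auto
  then have "card (bits (Node x b) \<inter> bits M) =
    (if x = Leaf \<or> val_hd M = Leaf then 0 else 1) + card (bits b \<inter> bits (val_tl M))"
    by (auto simp: card_image card_insert_if)
  then show ?case using 2 by (cases r) auto
qed simp

lemma vle_iff: "vle a b \<longleftrightarrow> card (bits a) \<le> card (bits b)"
  by (induction a b rule: vle.induct) (auto simp: card_bits_Node simp del: bits.simps(2))

lemma bits_vstep: "bits (vstep b rows acc) = bits acc \<union> (\<Union>i\<in>bits b. bits (vnth rows i))"
proof (induction b rows acc rule: vstep.induct)
  case (2 b row rows acc)
  show ?case by (subst bits_unfold[of b]) (use 2 in \<open>auto simp: bits_vor\<close>)
qed simp

lemma vdom_iff:
  "vdom C rows t \<longleftrightarrow> (\<exists>u\<in>bits C. bits (vnth rows u) \<noteq> {} \<and> bits (vnth rows u) \<subseteq> bits t)"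
proof (induction C rows t rule: vdom.induct)
  case (2 C row rows t)
  show ?case by (subst bits_unfold[of C]) (use 2 in \<open>auto simp: vnonempty_iff vsub_iff\<close>)
qed simp

lemma vnorm_eq: "vnorm rows M = encode_vertex_set (len rows) (bits M)"
proof (induction rows M rule: vnorm.induct)
  case (2 x rows M)
  have "0 \<in> bits M \<longleftrightarrow> val_hd M \<noteq> Leaf" by (subst bits_unfold) auto
  then show ?case using 2
    by (simp add: encode_vertex_set_def encode_list_def map_upt_Suc Suc_in_bits del: upt_Suc)
qed (simp add: encode_vertex_set_def encode_list_def)

lemma len_encode_list: "len (encode_list f xs) = length xs"
  by (induction xs) (auto simp: encode_list_def)

lemma vnth_encode_list: "vnth (encode_list f xs) i = (if i < length xs then f (xs ! i) else Leaf)"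
proof (induction xs arbitrary: i)
  case (Cons x xs)
  then show ?case by (cases i) (auto simp: encode_list_def)
qed (auto simp: encode_list_def)

lemma in_bits_iff: "i \<in> bits a \<longleftrightarrow> vnth a i \<noteq> Leaf"
  by (induction a i rule: vnth.induct) auto

lemma rows_le_encode_list:
  "(\<And>x. x \<in> set xs \<Longrightarrow> len (f x) \<le> m) \<Longrightarrow> rows_le m (encode_list f xs)"
  by (induction xs) (auto simp: encode_list_def)

text \<open>
  The leaves of the search tree below the node at depth \<open>i\<close> with partial solution \<open>M\<close>; isolated
  vertices are forced.
\<close>

definition extensions :: "nat pair_pre_digraph \<Rightarrow> nat set \<Rightarrow> nat \<Rightarrow> nat set \<Rightarrow> nat set set" where
  "extensions G C i M = {X. multipacking G X \<and> M \<subseteq> X \<and>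
     X \<subseteq> M \<union> (C \<union> isolated G) \<inter> {i..} \<and> isolated G \<inter> {i..} \<subseteq> X}"

locale coded_graph = pair_graph G for G :: "nat pair_pre_digraph" +
  fixes n :: nat and rows :: val
  assumes verts: "pverts G = {..<n}"
    and len_rows: "len rows = n"
    and bits_row: "bits (vnth rows u) = neighbors G u"
begin

section \<open>Checking, elimination and search on an encoded graph\<close>

lemma bits_vstep_nbhd:
  assumes "bits b = nbhd G s v"
  shows "bits (vstep b rows b) = nbhd G (Suc s) v"
  \<comment> \<open>\<open>vstep\<close> follows arcs out of the ball, \<open>nbhd_Suc\<close> arcs
    into it; symmetry identifies the two.\<close>
  using assms by (auto simp: bits_vstep bits_row nbhd_Suc neighbors_def intro: arcs_symmetric)

text \<open>The invariant reads \<open>len r\<close> as the radius of the current ball. Testing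
  begins with the next radius, so a start at radius 0 covers the radii from 1 on.\<close>

lemma vballs_iff:
  assumes "bits b = nbhd G (len r) v"
  shows "vballs fuel b r rows M \<longleftrightarrow>
    (\<forall>s\<in>{len r<..len r + len fuel}. card (nbhd G s v \<inter> bits M) \<le> s)"
  using assms
proof (induction fuel arbitrary: b r)
  case (Node x fuel)
  have "{len r<..len r + len (Node x fuel)} =
    insert (Suc (len r)) {len (Node Leaf r)<..len (Node Leaf r) + len fuel}" by auto
  then show ?case
    using Node.IH(2)[of "vstep b rows b" "Node Leaf r"] bits_vstep_nbhd[OF Node.prems]
    by (simp add: vcount_iff)
qed simp

lemma vcheck_iff:
  assumes "bits e = {v}" "len todo + v = n"
  shows "vcheck todo e rows M \<longleftrightarrow>
    (\<forall>x\<in>{v..<n}. \<forall>s\<in>{1..n}. card (nbhd G s x \<inter> bits M) \<le> s)"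
  using assms
proof (induction todo arbitrary: e v)
  case (Node y todo)
  have v: "v < n" using Node.prems(2) by simp
  then have "{v..<n} = insert v {Suc v..<n}" by auto
  moreover have "vballs rows e Leaf rows M \<longleftrightarrow> (\<forall>s\<in>{1..n}. card (nbhd G s v \<inter> bits M) \<le> s)"
    using vballs_iff[of e Leaf v rows M] Node.prems(1) v
    by (simp add: nbhd_0 verts len_rows Ball_def Suc_le_eq)
  ultimately show ?case using Node.IH(2)[of "Node Leaf e" "Suc v"] Node.prems by simp
qed simp

lemma vcheck_multipacking:
  assumes "bits M \<subseteq> {..<n}"
  shows "vcheck rows vunit rows M \<longleftrightarrow> multipacking G (bits M)"
  using vcheck_iff[of vunit 0 rows M] multipacking_iff_bounded[of n "bits M"] assms
  by (simp add: verts len_rows lessThan_atLeast0)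

text \<open>Loop invariant: the candidates still contain a maximum multipacking, and no processed
  candidate is dominated by another one. Later deletions cannot create domination, and at the end
  every candidate has been processed.\<close>

lemma velim:
  assumes "bits e = {v}" "len todo + v = n" "\<And>i. vnth todo i = vnth rows (v + i)"
    and "bits C \<subseteq> {..<n}" "\<exists>M. maximum_multipacking G M \<and> M \<subseteq> bits C"
    and "\<And>u x. \<lbrakk>x < v; x \<in> bits C; u \<in> bits C\<rbrakk> \<Longrightarrow> \<not> nbr_dominates G u x"
  shows "bits (velim todo e rows C) \<subseteq> {..<n} \<and>
    (\<exists>M. maximum_multipacking G M \<and> M \<subseteq> bits (velim todo e rows C)) \<and>
    (\<forall>u\<in>bits (velim todo e rows C). \<forall>x\<in>bits (velim todo e rows C). \<not> nbr_dominates G u x)"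
  using assms
proof (induction todo arbitrary: e v C)
  case Leaf
  then show ?case by (auto simp: subset_eq)
next
  case (Node row todo)
  define D where "D = (if vdom (vdiff C e) rows (vor row e) then vdiff C e else C)"
  have row: "bits row = neighbors G v" using Node.prems(3)[of 0] by (simp add: bits_row)
  \<comment> \<open>Removing \<open>v\<close> from the candidates enforces
    \<open>u \<noteq> v\<close>, and \<open>vor row e\<close> is the closed neighborhood of
    \<open>v\<close>.\<close>
  have dom: "vdom (vdiff C e) rows (vor row e) \<longleftrightarrow> (\<exists>u\<in>bits C. nbr_dominates G u v)"
    using Node.prems(1) by (auto simp: vdom_iff bits_vdiff bits_vor bits_row row nbr_dominates_def)
  have D: "bits D = (if \<exists>u\<in>bits C. nbr_dominates G u v then bits C - {v} else bits C)"
    using Node.prems(1) dom by (simp add: D_def bits_vdiff)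
  have "\<exists>M. maximum_multipacking G M \<and> M \<subseteq> bits D"
  proof (cases "\<exists>u\<in>bits C. nbr_dominates G u v")
    case True
    then obtain u where u: "u \<in> bits C" "nbr_dominates G u v" by blast
    obtain M where M: "maximum_multipacking G M" "M \<subseteq> bits C" using Node.prems(5) by blast
    show ?thesis
    proof (cases "v \<in> M")
      case vM: True
      have mp: "multipacking G M" using M by (simp add: maximum_multipacking_def)
      have "maximum_multipacking G (insert u (M - {v}))"
        using M multipacking_exchange[OF mp u(2) vM] by (auto simp: maximum_multipacking_def)
      moreover have "insert u (M - {v}) \<subseteq> bits D" using D True M u by (auto simp: nbr_dominates_def)
      ultimately show ?thesis by blast
    next
      case False
      then show ?thesis using M D by (intro exI[of _ M]) auto
    qed
  next
    case False
    then show ?thesis using Node.prems(5) D by simp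
  qed
  moreover have "\<not> nbr_dominates G u x" if "x < Suc v" "x \<in> bits D" "u \<in> bits D" for u x
    using that Node.prems(6)[of x u] D by (auto simp: less_Suc_eq split: if_splits)
  moreover have "vnth todo i = vnth rows (Suc v + i)" for i
    using Node.prems(3)[of "Suc i"] by simp
  moreover have "bits D \<subseteq> {..<n}" using D Node.prems(4) by auto
  ultimately show ?case
    using Node.IH(2)[of "Node Leaf e" "Suc v" D] Node.prems(1,2) by (simp add: D_def)
qed

lemma finite_extensions: "finite (extensions G C i M)"
  by (rule finite_subset[of _ "Pow {..<n}"])
    (auto simp: extensions_def multipacking_def verts)

lemma extensions_end:
  assumes "multipacking G M"
  shows "extensions G C n M = {M}"
proof -
  have "X \<inter> {n..} = {}" if "multipacking G X" for X
    using that by (auto simp: multipacking_def verts)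
  moreover have "isolated G \<inter> {n..} = {}" by (auto simp: isolated_def verts)
  ultimately have "X = M" if "X \<in> extensions G C n M" for X
    using that unfolding extensions_def by blast
  then show ?thesis using assms \<open>isolated G \<inter> {n..} = {}\<close> by (auto simp: extensions_def)
qed

lemma atLeast_insert: "{v..} = insert v {Suc v..}" for v :: nat
  by auto

lemma extensions_isolated:
  "v \<in> isolated G \<Longrightarrow> extensions G C v M = extensions G C (Suc v) (insert v M)"
  by (auto simp: extensions_def atLeast_insert[of v])

text \<open>By heredity, no multipacking above \<open>M\<close> contains \<open>v\<close> unless
  \<open>insert v M\<close> is one itself.\<close>

lemma extensions_skip:
  assumes "v \<notin> isolated G" "v \<notin> C \<or> \<not> multipacking G (insert v M)"
  shows "extensions G C v M = extensions G C (Suc v) M"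
proof -
  have "v \<notin> C" if "multipacking G X" "M \<subseteq> X" "v \<in> X" for X
    using that assms(2) multipacking_subset[of X "insert v M"] by auto
  then show ?thesis using assms(1) by (auto simp: extensions_def atLeast_insert[of v])
qed

lemma extensions_branch:
  assumes "v \<notin> isolated G" "v \<in> C"
  shows "extensions G C v M = extensions G C (Suc v) M \<union> extensions G C (Suc v) (insert v M)"
  using assms by (auto simp: extensions_def atLeast_insert[of v])

lemma extensions_disjoint:
  assumes "v \<notin> M"
  shows "extensions G C (Suc v) M \<inter> extensions G C (Suc v) (insert v M) = {}"
  using assms by (auto simp: extensions_def)

text \<open>\<open>D\<close> is the fixed candidate set, of which \<open>C\<close> encodes the part
  from \<open>v\<close> on. Forced and pruned vertices leave the set of extensions unchanged, a
  branch splits it into two disjoint parts, and a leaf has exactly one; so leaves never outnumber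
  extensions.\<close>

lemma vsearch:
  assumes "bits e = {v}" "len todo + v = n" "\<And>i. vnth todo i = vnth rows (v + i)"
    and "\<And>i. i \<in> bits C \<longleftrightarrow> v + i \<in> D" "bits M \<subseteq> {..<v}" "multipacking G (bits M)"
  shows "bits (vsearch todo e C rows M) \<in> extensions G D v (bits M) \<and>
    (\<forall>X\<in>extensions G D v (bits M). card X \<le> card (bits (vsearch todo e C rows M))) \<and>
    search_leaves todo e C rows M \<le> card (extensions G D v (bits M))"
  using assms
proof (induction todo arbitrary: e v C M)
  case Leaf
  then show ?case by (simp add: extensions_end)
next
  case (Node row todo)
  let ?e = "Node Leaf e" and ?C = "val_tl C"
  have v: "v < n" using Node.prems(2) by simp
  have row: "vnonempty row \<longleftrightarrow> v \<notin> isolated G"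
    using Node.prems(3)[of 0] v by (simp add: vnonempty_iff bits_row isolated_def verts)
  have hd: "val_hd C = Leaf \<longleftrightarrow> v \<notin> D"
    using Node.prems(4)[of 0] bits_unfold[of C] by auto
  have ins: "bits (vor e M) = insert v (bits M)" using Node.prems(1) by (simp add: bits_vor)
  have chk: "vcheck rows vunit rows (vor e M) \<longleftrightarrow> multipacking G (insert v (bits M))"
    using vcheck_multipacking[of "vor e M"] Node.prems(5) v ins by fastforce
  have C: "i \<in> bits ?C \<longleftrightarrow> Suc v + i \<in> D" for i
    using Node.prems(4)[of "Suc i"] by (simp add: Suc_in_bits)
  have todo: "vnth todo i = vnth rows (Suc v + i)" for i using Node.prems(3)[of "Suc i"] by simp
  have sub: "bits M \<subseteq> {..<Suc v}" "insert v (bits M) \<subseteq> {..<Suc v}" using Node.prems(5) by auto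
  have out: "bits (vsearch todo ?e ?C rows M) \<in> extensions G D (Suc v) (bits M) \<and>
    (\<forall>X\<in>extensions G D (Suc v) (bits M). card X \<le> card (bits (vsearch todo ?e ?C rows M))) \<and>
    search_leaves todo ?e ?C rows M \<le> card (extensions G D (Suc v) (bits M))"
    using Node.prems(1,2,6) C todo sub by (intro Node.IH(2)) auto
  have into: "bits (vsearch todo ?e ?C rows (vor e M)) \<in> extensions G D (Suc v) (insert v (bits M)) \<and>
    (\<forall>X\<in>extensions G D (Suc v) (insert v (bits M)).
       card X \<le> card (bits (vsearch todo ?e ?C rows (vor e M)))) \<and>
    search_leaves todo ?e ?C rows (vor e M) \<le> card (extensions G D (Suc v) (insert v (bits M)))"
    if "multipacking G (insert v (bits M))"
    unfolding ins[symmetric]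
    using Node.prems(1,2) C todo sub that by (intro Node.IH(2)) (auto simp: ins)
  show ?case
  proof (cases "v \<in> isolated G")
    case True
    then have "multipacking G (insert v (bits M))"
      using Node.prems(6) by (intro multipacking_insert_isolated)
    then show ?thesis using into True row by (simp add: extensions_isolated)
  next
    case iso: False
    show ?thesis
    proof (cases "v \<in> D \<and> multipacking G (insert v (bits M))")
      case False
      then have "extensions G D v (bits M) = extensions G D (Suc v) (bits M)"
        using iso by (intro extensions_skip) auto
      then show ?thesis using out False row iso hd chk by auto
    next
      case True
      then have eq: "extensions G D v (bits M) =
        extensions G D (Suc v) (bits M) \<union> extensions G D (Suc v) (insert v (bits M))"
        using iso by (intro extensions_branch) auto
      moreover have "v \<notin> bits M" using Node.prems(5) by auto
      then have "card (extensions G D v (bits M)) =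
        card (extensions G D (Suc v) (bits M)) + card (extensions G D (Suc v) (insert v (bits M)))"
        unfolding eq by (intro card_Un_disjoint finite_extensions extensions_disjoint)
      ultimately show ?thesis
        using out into True row iso hd chk by (auto simp: vpick_def vle_iff)
    qed
  qed
qed

text \<open>Every set counted here contains all isolated vertices, so deleting them is injective;
  what is left is a packing of closed neighborhoods.\<close>

lemma card_extensions_le:
  assumes "C \<subseteq> {..<n}" "\<And>u x. \<lbrakk>u \<in> C; x \<in> C\<rbrakk> \<Longrightarrow> \<not> nbr_dominates G u x"
  shows "real (card (extensions G C 0 {})) \<le> 1.58 ^ n"
proof -
  let ?S = "\<lambda>v. insert v (neighbors G v)"
  let ?P = "packings ?S (C - isolated G)"
  have "X - isolated G \<in> ?P" if "X \<in> extensions G C 0 {}" for X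
  proof -
    have "multipacking G (X - isolated G)"
      by (rule multipacking_subset[of X]) (use that in \<open>auto simp: extensions_def\<close>)
    then show ?thesis using that multipacking_disjoint
      by (auto simp: packings_def extensions_def)
  qed
  moreover have "inj_on (\<lambda>X. X - isolated G) (extensions G C 0 {})"
    by (rule inj_onI) (auto simp: extensions_def)
  moreover have "finite ?P"
    using finite_subset[OF assms(1)] by (intro finite_packings) simp
  ultimately have "card (extensions G C 0 {}) \<le> card ?P"
    by (intro card_inj_on_le[of "\<lambda>X. X - isolated G"]) auto
  also have "real (card ?P) \<le> 1.58 ^ card (pverts G)"
    using assms by (intro card_packings_neighbors) (auto simp: verts)
  finally show ?thesis by (simp add: verts)
qed

lemma ex_maximum_multipacking: "\<exists>M. maximum_multipacking G M"
proof -
  have "multipacking G {}" by (simp add: multipacking_def)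
  moreover have "\<forall>M. multipacking G M \<longrightarrow> card M < Suc n"
    using card_mono[of "{..<n}"] by (auto simp: multipacking_def verts less_Suc_eq_le)
  ultimately show ?thesis
    unfolding maximum_multipacking_def by (rule Lattices_Big.ex_has_greatest_nat)
qed

lemma program_correct:
  assumes "bits rows = {..<n}"
  defines "C \<equiv> velim rows vunit rows rows"
  shows "maximum_multipacking G (bits (vsearch rows vunit C rows Leaf))"
    and "real (search_leaves rows vunit C rows Leaf) \<le> 1.58 ^ n"
proof -
  let ?X = "bits (vsearch rows vunit C rows Leaf)"
  have "\<exists>M. maximum_multipacking G M \<and> M \<subseteq> bits rows"
    using ex_maximum_multipacking assms(1)
    by (auto simp: maximum_multipacking_def multipacking_def verts)
  then have C: "bits C \<subseteq> {..<n}" "\<exists>M. maximum_multipacking G M \<and> M \<subseteq> bits C"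
    "\<forall>u\<in>bits C. \<forall>x\<in>bits C. \<not> nbr_dominates G u x"
    using velim[of vunit 0 rows rows] assms(1) unfolding C_def by (simp_all add: len_rows)
  have s: "?X \<in> extensions G (bits C) 0 {}" "\<forall>X\<in>extensions G (bits C) 0 {}. card X \<le> card ?X"
    "search_leaves rows vunit C rows Leaf \<le> card (extensions G (bits C) 0 {})"
    using vsearch[of vunit 0 rows C "bits C" Leaf] by (simp_all add: len_rows multipacking_def)
  obtain M where M: "maximum_multipacking G M" "M \<subseteq> bits C" using C(2) by blast
  \<comment> \<open>Adding the isolated vertices makes \<open>M\<close> one of the enumerated sets
    without decreasing its size, so the set found is at least as large.\<close>
  then have mp: "multipacking G (M \<union> isolated G)"
    by (intro multipacking_Un_isolated) (auto simp: maximum_multipacking_def)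
  then have "M \<union> isolated G \<in> extensions G (bits C) 0 {}" using M by (auto simp: extensions_def)
  then have "card (M \<union> isolated G) \<le> card ?X" using s(2) by blast
  moreover have "finite (M \<union> isolated G)"
    using mp pair_finite_verts unfolding multipacking_def by (meson finite_subset)
  then have "card M \<le> card (M \<union> isolated G)" by (intro card_mono) auto
  ultimately have "card M \<le> card ?X" by linarith
  moreover have "multipacking G ?X" using s(1) by (simp add: extensions_def)
  ultimately show "maximum_multipacking G ?X"
    using M(1) unfolding maximum_multipacking_def by (meson order_trans)
  have "real (card (extensions G (bits C) 0 {})) \<le> 1.58 ^ n"
    using C by (intro card_extensions_le) auto
  then show "real (search_leaves rows vunit C rows Leaf) \<le> 1.58 ^ n"
    using s(3) by (meson of_nat_mono order_trans)
qed

end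

section \<open>Encoded input and total running time\<close>

lemma coded_graph_encode_graph:
  assumes "pair_graph G" "pverts G = {..<n}"
  shows "coded_graph G n (encode_graph n G)"
proof -
  interpret pair_graph G by fact
  have "bits (vnth (encode_graph n G) u) = neighbors G u" for u
    using wellformed'[of u] assms(2)
    by (auto simp: encode_graph_def vnth_encode_list in_bits_iff neighbors_def split: if_splits)
  then show ?thesis
    using assms(2) by unfold_locales (auto simp: encode_graph_def len_encode_list)
qed

text \<open>If there is any row, then \<open>n\<close> is positive and no row is
  \<open>Leaf\<close>; the matrix thus also encodes the full vertex set.\<close>

lemma bits_encode_graph: "bits (encode_graph n G) = {..<n}"
proof -
  have "encode_list f xs \<noteq> Leaf" if "xs \<noteq> []" for f :: "bool \<Rightarrow> val" and xs
    using that by (cases xs) (auto simp: encode_list_def)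
  then show ?thesis
    by (auto simp: encode_graph_def in_bits_iff vnth_encode_list split: if_splits)
qed

text \<open>The number of leaves is an integer, so the floor bounds it too; the final 2 pays for the
  initial call.\<close>

definition total_time :: "nat \<Rightarrow> nat" where
  "total_time n = elim_time n + 20 * n + 100 + Suc n * nat \<lfloor>1.58 ^ n :: real\<rfloor> * search_time n + 2"

lemma search_time_le: "search_time n \<le> 1100 * Suc n ^ 4"
  and elim_time_le: "elim_time n \<le> 400 * Suc n ^ 4"
proof -
  define B where "B = Suc n"
  have B: "1 \<le> B" "n \<le> B" by (simp_all add: B_def)
  have p: "1 \<le> B" "B \<le> B^2" "B^2 \<le> B^3" "B^3 \<le> B^4"
    using B by (auto intro!: power_increasing simp: self_le_power)
  have "step_time n \<le> B * (80 * B)" unfolding step_time_def B_def[symmetric] using B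
    by (intro mult_left_mono) auto
  then have "step_time n \<le> 80 * B^2" by (simp add: power2_eq_square)
  then have "balls_time n \<le> B * (290 * B^2)" unfolding balls_time_def B_def[symmetric] using B p
    by (intro mult_left_mono) auto
  then have "balls_time n \<le> 290 * B^3" by (simp add: power_numeral_reduce)
  then have "check_time n \<le> B * (340 * B^3)" unfolding check_time_def B_def[symmetric] using B p
    by (intro mult_left_mono) auto
  then have "check_time n \<le> 340 * B^4" by (simp add: power_numeral_reduce)
  then show "search_time n \<le> 1100 * Suc n ^ 4"
    unfolding search_time_def B_def[symmetric] using B p by linarith
  have "dom_time n \<le> B * (140 * B)" unfolding dom_time_def B_def[symmetric] using B
    by (intro mult_left_mono) auto
  then have "dom_time n \<le> 140 * B^2" by (simp add: power2_eq_square)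
  then have "elim_time n \<le> B * (400 * B^2)" unfolding elim_time_def B_def[symmetric] using B p
    by (intro mult_left_mono) auto
  then have "elim_time n \<le> 400 * B^3" by (simp add: power_numeral_reduce)
  then show "elim_time n \<le> 400 * Suc n ^ 4" unfolding B_def[symmetric] using p by linarith
qed

lemma total_time_O_star: "(\<lambda>n. real (total_time n)) \<in> O_star (\<lambda>n. 1.58 ^ n)"
proof -
  \<comment> \<open>The constant is \<open>2000 * 2^5\<close>, from \<open>Suc n \<le> 2 * n\<close>
    for positive \<open>n\<close>. The exponent 5 combines the depth of the search tree with quartic
    work per node.\<close>
  have bound: "real (total_time n) \<le> 64000 * (real n ^ 5 * 1.58 ^ n)" if "1 \<le> n" for n
  proof -
    define B where "B = Suc n"
    define L where "L = nat \<lfloor>1.58 ^ n :: real\<rfloor>"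
    have L: "1 \<le> L" "real L \<le> 1.58 ^ n"
      using one_le_power[of "1.58 :: real" n] by (simp_all add: L_def le_nat_floor)
    have B: "1 \<le> B" "n \<le> B" by (simp_all add: B_def)
    then have p: "1 \<le> B^5" "B \<le> B^5" "B^4 \<le> B^5"
      by (auto intro: self_le_power power_increasing)
    have q: "B^5 \<le> B^5 * L" using L by simp
    have "B * L * search_time n \<le> B * L * (1100 * B ^ 4)"
      using search_time_le[of n] by (intro mult_left_mono) (auto simp: B_def)
    also have "\<dots> = 1100 * (B^5 * L)" by (simp add: power_numeral_reduce)
    finally have "total_time n \<le> 2000 * (B^5 * L)"
      unfolding total_time_def B_def[symmetric] L_def[symmetric]
      using elim_time_le[of n, folded B_def] B p q by linarith
    then have "real (total_time n) \<le> 2000 * (real B ^ 5 * real L)"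
      by (metis (no_types, lifting) of_nat_le_iff of_nat_mult of_nat_numeral of_nat_power)
    also have "\<dots> \<le> 2000 * ((2 * real n) ^ 5 * 1.58 ^ n)"
      using L that by (intro mult_left_mono mult_mono power_mono) (auto simp: B_def)
    finally show ?thesis by (simp add: power_mult_distrib)
  qed
  have "(\<lambda>n. real (total_time n)) \<in> O(\<lambda>n. real n ^ 5 * 1.58 ^ n)"
    by (rule bigoI[of _ 64000], rule eventually_sequentiallyI[of 1]) (use bound in auto)
  then show ?thesis unfolding O_star_def by blast
qed

theorem theorem3:
  shows "\<exists>(P :: program) (T :: nat \<Rightarrow> nat).
    (\<lambda>n. real (T n)) \<in> O_star (\<lambda>n. 1.58 ^ n) \<and>
    (\<forall>(n :: nat) (G :: nat pair_pre_digraph).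
       pair_graph G \<and> pverts G = {..<n} \<longrightarrow>
       (\<exists>M. maximum_multipacking G M \<and>
            computes_within P (encode_graph n G) (encode_vertex_set n M) (T n)))"
proof (intro exI conjI allI impI)
  show "(\<lambda>n. real (total_time n)) \<in> O_star (\<lambda>n. 1.58 ^ n)" by (rule total_time_O_star)
next
  fix n and G :: "nat pair_pre_digraph"
  assume "pair_graph G \<and> pverts G = {..<n}"
  then interpret coded_graph G n "encode_graph n G" by (intro coded_graph_encode_graph) auto
  define rows where "rows = encode_graph n G"
  define C where "C = velim rows vunit rows rows"
  let ?X = "vsearch rows vunit C rows Leaf"
  note correct = program_correct[OF bits_encode_graph, folded rows_def, folded C_def]
  show "maximum_multipacking G (bits ?X)" by (rule correct(1))
  have "search_leaves rows vunit C rows Leaf \<le> nat \<lfloor>1.58 ^ n :: real\<rfloor>"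
    using correct(2) by (rule le_nat_floor)
  moreover have "rows_le n rows" "len rows \<le> n"
    unfolding rows_def encode_graph_def by (auto simp: len_encode_list intro!: rows_le_encode_list)
  then have "runs prog 0 [rows] (vnorm rows ?X)
    (elim_time n + 20 * n + 100 + Suc n * search_leaves rows vunit C rows Leaf * search_time n)"
    unfolding C_def by (rule runs_main)
  ultimately have "runs prog 0 [rows] (vnorm rows ?X)
    (elim_time n + 20 * n + 100 + Suc n * nat \<lfloor>1.58 ^ n :: real\<rfloor> * search_time n)"
    by (elim runs_mono) (intro add_left_mono mult_le_mono, auto)
  then have "computes_within prog rows (vnorm rows ?X) (total_time n)"
    unfolding total_time_def by (rule runs_computes_within) (simp add: prog_def)
  then show "computes_within prog (encode_graph n G) (encode_vertex_set n (bits ?X)) (total_time n)"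
    by (simp add: vnorm_eq rows_def len_rows)
qed

end
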